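(* Let $K$ be a field and let $A$ be a $K$-algebra with enough idempotents, with system of idempotents $(e_\alpha)_{\alpha\in R}$. Then $(A^0,\Delta,\varepsilon)$ is a (coassociative) coalgebra with counit.
   Context: A $K$-algebra $A$ (associative, not necessarily with unit) has enough idempotents if there is a system $(e_\alpha)_{\alpha\in R}$ of pairwise orthogonal idempotents of $A$ with $A=\bigoplus_{\alpha\in R}Ae_\alpha=\bigoplus_{\alpha\in R}e_\alpha A$. The finite dual is $$A^0=\{f\in A^*\mid \mathrm{Ker}(f)\text{ contains a two-sided ideal of }A\text{ of finite codimension}\},$$ a subspace of $A^*$. Let $M:A\otimes A\to A$ be the multiplication, $M^*:A^*\to (A\otimes A)^*$ its dual, and $\psi:A^*\otimes A^*\to (A\otimes A)^*$ the natural linear injection. One has $M^*(A^0)\subseteq\psi(A^0\otimes A^0)$, and $\Delta:A^0\to A^0\otimes A^0$ is defined by $\Delta=\psi^{-1}M^*$; that is, $\Delta(f)=\sum_i u_i\otimes v_i$ (with $u_i,v_i\in A^0$) if and only if $f(xy)=\sum_i u_i(x)v_i(y)$ for all $x,y\in A$. For $f\in A^0$ only finitely many $e_\alpha$ lie outside $\mathrm{Ker}(f)$, and $\varepsilon:A^0\to K$ is defined by $\varepsilon(f)=\sum_{\alpha\in R}f(e_\alpha)$. *)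

theory Defs
  imports Complex_Main "HOL-Library.Function_Algebras"
begin

section \<open>Vector spaces and linear maps\<close>

text \<open>
  A vector space is a subspace of a type that is a vector space under the given scalar
  multiplication; the addition comes from the type. Functions with values in a vector space
  carry the pointwise operations.
\<close>

record ('k, 'v) vsp =
  carrier :: "'v set"
  scal :: "'k \<Rightarrow> 'v \<Rightarrow> 'v"

definition vspace :: "('k::field, 'v::ab_group_add) vsp \<Rightarrow> bool" where
  "vspace V \<longleftrightarrow> vector_space (scal V) \<and> module.subspace (scal V) (carrier V)"

definition ground :: "('k::field, 'k) vsp" where
  "ground = \<lparr>carrier = UNIV, scal = (*)\<rparr>"

definition fun_scale :: "'k::field \<Rightarrow> ('i \<Rightarrow> 'k) \<Rightarrow> 'i \<Rightarrow> 'k" where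
  "fun_scale c f = (\<lambda>i. c * f i)"

definition lin :: "('k::field, 'v::ab_group_add) vsp \<Rightarrow> ('k, 'w::ab_group_add) vsp \<Rightarrow> ('v \<Rightarrow> 'w) \<Rightarrow> bool" where
  "lin V W f \<longleftrightarrow>
     (\<forall>x\<in>carrier V. f x \<in> carrier W) \<and>
     (\<forall>x\<in>carrier V. \<forall>y\<in>carrier V. f (x + y) = f x + f y) \<and>
     (\<forall>c. \<forall>x\<in>carrier V. f (scal V c x) = scal W c (f x))"

definition bilin :: "('k::field, 'v::ab_group_add) vsp \<Rightarrow> ('k, 'w::ab_group_add) vsp \<Rightarrow>
    ('k, 'u::ab_group_add) vsp \<Rightarrow> ('v \<Rightarrow> 'w \<Rightarrow> 'u) \<Rightarrow> bool" where
  "bilin V W U B \<longleftrightarrow>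
     (\<forall>v\<in>carrier V. lin W U (\<lambda>w. B v w)) \<and> (\<forall>w\<in>carrier W. lin V U (\<lambda>v. B v w))"

text \<open>Functionals are extended by zero outside the carrier, so that they are determined by
  their values on it.\<close>

definition dual :: "('k::field, 'v::ab_group_add) vsp \<Rightarrow> ('k, 'v \<Rightarrow> 'k) vsp" where
  "dual V = \<lparr>carrier = {f. lin V ground f \<and> (\<forall>x. x \<notin> carrier V \<longrightarrow> f x = 0)}, scal = fun_scale\<rparr>"


section \<open>Tensor products\<close>

text \<open>
  The tensor product over a field is realised inside the dual of the space of bilinear forms:
  \<open>v \<otimes> w\<close> is evaluation at \<open>(v, w)\<close>, and the tensor product is the span of these
  evaluations. The results \<open>tensor_lift_exists\<close> and \<open>tensor_lift_unique\<close> below show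
  that this is a tensor product, i.e. that it has the universal property; all later
  constructions use it through \<open>tensor_lift\<close> only.
\<close>

definition tns :: "('k::field, 'v::ab_group_add) vsp \<Rightarrow> ('k, 'w::ab_group_add) vsp \<Rightarrow>
    'v \<Rightarrow> 'w \<Rightarrow> ('v \<Rightarrow> 'w \<Rightarrow> 'k) \<Rightarrow> 'k" where
  "tns V W v w = (\<lambda>\<beta>. if bilin V W ground \<beta> then \<beta> v w else 0)"

definition tensor :: "('k::field, 'v::ab_group_add) vsp \<Rightarrow> ('k, 'w::ab_group_add) vsp \<Rightarrow>
    ('k, ('v \<Rightarrow> 'w \<Rightarrow> 'k) \<Rightarrow> 'k) vsp" where
  "tensor V W =
     \<lparr>carrier = module.span fun_scale {tns V W v w | v w. v \<in> carrier V \<and> w \<in> carrier W},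
      scal = fun_scale\<rparr>"

text \<open>The linear map on the tensor product induced by a bilinear map, extended by zero.\<close>

definition tensor_lift :: "('k::field, 'v::ab_group_add) vsp \<Rightarrow> ('k, 'w::ab_group_add) vsp \<Rightarrow>
    ('k, 'u::ab_group_add) vsp \<Rightarrow> ('v \<Rightarrow> 'w \<Rightarrow> 'u) \<Rightarrow> (('v \<Rightarrow> 'w \<Rightarrow> 'k) \<Rightarrow> 'k) \<Rightarrow> 'u" where
  "tensor_lift V W U B = (THE L. lin (tensor V W) U L \<and>
     (\<forall>v\<in>carrier V. \<forall>w\<in>carrier W. L (tns V W v w) = B v w) \<and>
     (\<forall>t. t \<notin> carrier (tensor V W) \<longrightarrow> L t = 0))"

lemma vector_space_fun_scale: "vector_space (fun_scale :: 'k::field \<Rightarrow> ('i \<Rightarrow> 'k) \<Rightarrow> 'i \<Rightarrow> 'k)"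
  by unfold_locales (auto simp: fun_scale_def fun_eq_iff algebra_simps)

lemma vspace_tensor:
  fixes V :: "('k::field, 'v::ab_group_add) vsp" and W :: "('k, 'w::ab_group_add) vsp"
  shows "vspace (tensor V W)"
proof -
  interpret F: vector_space "fun_scale :: 'k \<Rightarrow> (('v \<Rightarrow> 'w \<Rightarrow> 'k) \<Rightarrow> 'k) \<Rightarrow> _"
    by (rule vector_space_fun_scale)
  show ?thesis
    by (simp add: vspace_def tensor_def vector_space_fun_scale F.subspace_span)
qed

lemma tns_in_tensor:
  fixes V :: "('k::field, 'v::ab_group_add) vsp" and W :: "('k, 'w::ab_group_add) vsp"
  assumes "v \<in> carrier V" "w \<in> carrier W"
  shows "tns V W v w \<in> carrier (tensor V W)"
proof -
  interpret F: vector_space "fun_scale :: 'k \<Rightarrow> (('v \<Rightarrow> 'w \<Rightarrow> 'k) \<Rightarrow> 'k) \<Rightarrow> _"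
    by (rule vector_space_fun_scale)
  show ?thesis
    using assms by (auto simp: tensor_def intro!: F.span_base)
qed

lemma tensor_induct [consumes 1, case_names base step]:
  fixes V :: "('k::field, 'v::ab_group_add) vsp" and W :: "('k, 'w::ab_group_add) vsp"
  assumes "t \<in> carrier (tensor V W)" and "P 0"
    and step: "\<And>c v w t. v \<in> carrier V \<Longrightarrow> w \<in> carrier W \<Longrightarrow> t \<in> carrier (tensor V W) \<Longrightarrow> P t \<Longrightarrow>
      P (fun_scale c (tns V W v w) + t)"
  shows "P t"
proof -
  interpret F: vector_space "fun_scale :: 'k \<Rightarrow> (('v \<Rightarrow> 'w \<Rightarrow> 'k) \<Rightarrow> 'k) \<Rightarrow> _"
    by (rule vector_space_fun_scale)
  let ?S = "{tns V W v w | v w. v \<in> carrier V \<and> w \<in> carrier W}"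
  have "t \<in> F.span ?S" using assms(1) by (simp add: tensor_def)
  then have "t \<in> F.span ?S \<and> P t"
  proof (induction rule: F.span_induct_alt)
    case base
    show ?case using F.span_zero \<open>P 0\<close> by (rule conjI)
  next
    case (step c x y)
    then obtain v w where vw: "x = tns V W v w" "v \<in> carrier V" "w \<in> carrier W" by blast
    have "P (fun_scale c x + y)"
      unfolding vw(1) using step vw(2,3) by (intro assms(3)) (auto simp: tensor_def)
    moreover have "fun_scale c x + y \<in> F.span ?S"
      using step by (intro F.span_add F.span_scale[OF F.span_base]) auto
    ultimately show ?case by blast
  qed
  then show ?thesis ..
qed

lemma functionals_separate:
  fixes s :: "'k::field \<Rightarrow> 'u::ab_group_add \<Rightarrow> 'u"
  assumes "vector_space s" and "\<And>\<phi>. Vector_Spaces.linear s (*) \<phi> \<Longrightarrow> \<phi> x = \<phi> y"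
  shows "x = y"
proof (rule ccontr)
  interpret U: vector_space s by fact
  interpret K: vector_space "(*) :: 'k \<Rightarrow> 'k \<Rightarrow> 'k"
    by unfold_locales (auto simp: algebra_simps)
  interpret P: vector_space_pair s "(*) :: 'k \<Rightarrow> 'k \<Rightarrow> 'k" ..
  assume "x \<noteq> y"
  then have "U.independent {x - y}" by simp
  from P.linear_independent_extend[OF this, of "\<lambda>_. 1"]
  obtain \<phi> where \<phi>: "Vector_Spaces.linear s (*) \<phi>" "\<phi> (x - y) = 1" by auto
  interpret \<phi>: Vector_Spaces.linear s "(*)" \<phi> by fact
  show False using \<phi>(2) assms(2)[OF \<phi>(1)] by (simp add: \<phi>.diff)
qed

theorem tensor_lift_unique:
  fixes V :: "('k::field, 'v::ab_group_add) vsp" and W :: "('k, 'w::ab_group_add) vsp"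
    and U :: "('k, 'u::ab_group_add) vsp"
  assumes "lin (tensor V W) U L" "lin (tensor V W) U L'" and "vspace U"
    and "\<And>v w. v \<in> carrier V \<Longrightarrow> w \<in> carrier W \<Longrightarrow> L (tns V W v w) = L' (tns V W v w)"
    and t: "t \<in> carrier (tensor V W)"
  shows "L t = L' t"
proof -
  interpret F: vector_space "fun_scale :: 'k \<Rightarrow> (('v \<Rightarrow> 'w \<Rightarrow> 'k) \<Rightarrow> 'k) \<Rightarrow> _"
    by (rule vector_space_fun_scale)
  have sub: "F.subspace (carrier (tensor V W))" by (simp add: tensor_def F.subspace_span)
  have sc: "scal (tensor V W) = fun_scale" by (simp add: tensor_def)
  have 0: "M 0 = 0" if "lin (tensor V W) U M" for M
  proof -
    have "M (0 + 0) = M 0 + M 0"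
      using that F.subspace_0[OF sub] unfolding lin_def by blast
    then show ?thesis by simp
  qed
  have st: "M (fun_scale c (tns V W v w) + t) = scal U c (M (tns V W v w)) + M t"
    if "lin (tensor V W) U M" "v \<in> carrier V" "w \<in> carrier W" "t \<in> carrier (tensor V W)"
    for M c v w t
  proof -
    have x: "tns V W v w \<in> carrier (tensor V W)" using tns_in_tensor that(2,3) .
    have cx: "fun_scale c (tns V W v w) \<in> carrier (tensor V W)"
      by (rule F.subspace_scale[OF sub x])
    have "M (fun_scale c (tns V W v w) + t) = M (fun_scale c (tns V W v w)) + M t"
      using that(1,4) cx by (simp add: lin_def)
    also have "M (fun_scale c (tns V W v w)) = scal U c (M (tns V W v w))"
      using that(1) x by (simp add: lin_def sc)
    finally show ?thesis .
  qed
  show ?thesis using t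
  proof (induction rule: tensor_induct)
    case base
    show ?case by (simp only: 0[OF assms(1)] 0[OF assms(2)])
  next
    case (step c v w t)
    then show ?case
      using st[OF assms(1), of v w t c] st[OF assms(2), of v w t c] assms(4)[of v w]
      by (simp only:)
  qed
qed

theorem tensor_lift_exists:
  fixes V :: "('k::field, 'v::ab_group_add) vsp" and W :: "('k, 'w::ab_group_add) vsp"
    and U :: "('k, 'u::ab_group_add) vsp"
  assumes "vspace U" and B: "bilin V W U B"
  shows "\<exists>L. lin (tensor V W) U L \<and>
    (\<forall>v\<in>carrier V. \<forall>w\<in>carrier W. L (tns V W v w) = B v w) \<and>
    (\<forall>t. t \<notin> carrier (tensor V W) \<longrightarrow> L t = 0)"
proof -
  interpret F: vector_space "fun_scale :: 'k \<Rightarrow> (('v \<Rightarrow> 'w \<Rightarrow> 'k) \<Rightarrow> 'k) \<Rightarrow> _"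
    by (rule vector_space_fun_scale)
  have vs: "vector_space (scal U)" using assms(1) by (simp add: vspace_def)
  interpret U: vector_space "scal U" by (rule vs)
  have subU: "U.subspace (carrier U)" using assms(1) by (simp add: vspace_def)
  have subT: "F.subspace (carrier (tensor V W))" by (simp add: tensor_def F.subspace_span)
  have sc: "scal (tensor V W) = fun_scale" by (simp add: tensor_def)
  define Q where "Q t u \<longleftrightarrow> u \<in> carrier U \<and>
    (\<forall>\<phi>. Vector_Spaces.linear (scal U) (*) \<phi> \<longrightarrow> \<phi> u = t (\<lambda>v w. \<phi> (B v w)))" for t u
  have bl: "bilin V W ground (\<lambda>v w. \<phi> (B v w))" if "Vector_Spaces.linear (scal U) (*) \<phi>" for \<phi>
  proof -
    interpret \<phi>: Vector_Spaces.linear "scal U" "(*)" \<phi> by fact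
    show ?thesis
      using B by (auto simp: bilin_def lin_def ground_def \<phi>.add \<phi>.scale)
  qed
  have Q_tns: "Q (tns V W v w) (B v w)" if "v \<in> carrier V" "w \<in> carrier W" for v w
    using that B bl by (auto simp: Q_def tns_def bilin_def lin_def)
  have Q_add: "Q (t + t') (u + u')" if "Q t u" "Q t' u'" for t t' u u'
    unfolding Q_def
  proof (intro conjI allI impI)
    show "u + u' \<in> carrier U" using that U.subspace_add[OF subU] by (auto simp: Q_def)
    fix \<phi> assume *: "Vector_Spaces.linear (scal U) (*) \<phi>"
    interpret \<phi>: Vector_Spaces.linear "scal U" "(*)" \<phi> by fact
    show "\<phi> (u + u') = (t + t') (\<lambda>v w. \<phi> (B v w))" using that * by (simp add: Q_def \<phi>.add)
  qed
  have Q_scale: "Q (fun_scale c t) (scal U c u)" if "Q t u" for c t u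
    unfolding Q_def
  proof (intro conjI allI impI)
    show "scal U c u \<in> carrier U" using that U.subspace_scale[OF subU] by (auto simp: Q_def)
    fix \<phi> assume *: "Vector_Spaces.linear (scal U) (*) \<phi>"
    interpret \<phi>: Vector_Spaces.linear "scal U" "(*)" \<phi> by fact
    show "\<phi> (scal U c u) = fun_scale c t (\<lambda>v w. \<phi> (B v w))"
      using that * by (simp add: Q_def \<phi>.scale fun_scale_def)
  qed
  have Q_0: "Q 0 0"
    using U.subspace_0[OF subU] by (auto simp: Q_def linear_iff_module_hom module_hom.zero)
  have ex: "\<exists>u. Q t u" if "t \<in> carrier (tensor V W)" for t
    using that
  proof (induction rule: tensor_induct)
    case base
    show ?case using Q_0 by (rule exI)
  next
    case (step c v w t)
    then obtain u where "Q t u" by (elim exE)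
    then have "Q (fun_scale c (tns V W v w) + t) (scal U c (B v w) + u)"
      by (intro Q_add Q_scale Q_tns step)
    then show ?case by (rule exI)
  qed
  have un: "u = u'" if "Q t u" "Q t u'" for t u u'
  proof (rule functionals_separate[OF vs])
    fix \<phi> assume "Vector_Spaces.linear (scal U) (*) \<phi>"
    then have "\<phi> u = t (\<lambda>v w. \<phi> (B v w))" "\<phi> u' = t (\<lambda>v w. \<phi> (B v w))"
      using that unfolding Q_def by blast+
    then show "\<phi> u = \<phi> u'" by (simp only:)
  qed
  define L where "L t = (if t \<in> carrier (tensor V W) then THE u. Q t u else 0)" for t
  have QL: "Q t (L t)" if "t \<in> carrier (tensor V W)" for t
  proof -
    have "\<exists>!u. Q t u" using ex[OF that] un by (intro ex_ex1I)
    then have "Q t (THE u. Q t u)" by (rule theI')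
    then show ?thesis using that by (simp add: L_def)
  qed
  have "lin (tensor V W) U L"
    unfolding lin_def sc
  proof (intro conjI ballI allI)
    fix x y c assume x: "x \<in> carrier (tensor V W)"
    show "L x \<in> carrier U" using QL[OF x] by (simp add: Q_def)
    show "L (fun_scale c x) = scal U c (L x)"
      by (intro un[OF QL Q_scale] F.subspace_scale[OF subT] QL x)
    assume y: "y \<in> carrier (tensor V W)"
    show "L (x + y) = L x + L y"
      by (intro un[OF QL Q_add] F.subspace_add[OF subT] QL x y)
  qed
  moreover have "\<forall>v\<in>carrier V. \<forall>w\<in>carrier W. L (tns V W v w) = B v w"
    by (intro ballI un[OF QL Q_tns] tns_in_tensor)
  moreover have "\<forall>t. t \<notin> carrier (tensor V W) \<longrightarrow> L t = 0" by (simp add: L_def)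
  ultimately show ?thesis by blast
qed

text \<open>The map \<open>f \<otimes> g\<close> from \<open>V \<otimes> W\<close> to \<open>V' \<otimes> W'\<close>.\<close>

definition tensor_map :: "('k::field, 'v::ab_group_add) vsp \<Rightarrow> ('k, 'w::ab_group_add) vsp \<Rightarrow>
    ('k, 'x::ab_group_add) vsp \<Rightarrow> ('k, 'y::ab_group_add) vsp \<Rightarrow> ('v \<Rightarrow> 'x) \<Rightarrow> ('w \<Rightarrow> 'y) \<Rightarrow>
    (('v \<Rightarrow> 'w \<Rightarrow> 'k) \<Rightarrow> 'k) \<Rightarrow> ('x \<Rightarrow> 'y \<Rightarrow> 'k) \<Rightarrow> 'k" where
  "tensor_map V W V' W' f g =
     tensor_lift V W (tensor V' W') (\<lambda>v w. tns V' W' (f v) (g w))"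

text \<open>The associativity isomorphism from \<open>(U \<otimes> V) \<otimes> W\<close> to \<open>U \<otimes> (V \<otimes> W)\<close>.\<close>

definition tensor_assoc :: "('k::field, 'u::ab_group_add) vsp \<Rightarrow> ('k, 'v::ab_group_add) vsp \<Rightarrow>
    ('k, 'w::ab_group_add) vsp \<Rightarrow>
    (((('u \<Rightarrow> 'v \<Rightarrow> 'k) \<Rightarrow> 'k) \<Rightarrow> 'w \<Rightarrow> 'k) \<Rightarrow> 'k) \<Rightarrow>
    (('u \<Rightarrow> (('v \<Rightarrow> 'w \<Rightarrow> 'k) \<Rightarrow> 'k) \<Rightarrow> 'k) \<Rightarrow> 'k)" where
  "tensor_assoc U V W =
     tensor_lift (tensor U V) W (tensor U (tensor V W))
       (\<lambda>t w. tensor_lift U V (tensor U (tensor V W))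
                (\<lambda>u v. tns U (tensor V W) u (tns V W v w)) t)"


section \<open>Coalgebras\<close>

definition coalgebra :: "('k::field, 'c::ab_group_add) vsp \<Rightarrow>
    ('c \<Rightarrow> ('c \<Rightarrow> 'c \<Rightarrow> 'k) \<Rightarrow> 'k) \<Rightarrow> ('c \<Rightarrow> 'k) \<Rightarrow> bool" where
  "coalgebra C \<Delta> \<epsilon> \<longleftrightarrow>
     vspace C \<and> lin C (tensor C C) \<Delta> \<and> lin C ground \<epsilon> \<and>
     (\<forall>c\<in>carrier C.
        tensor_assoc C C C (tensor_map C C (tensor C C) C \<Delta> id (\<Delta> c)) =
        tensor_map C C C (tensor C C) id \<Delta> (\<Delta> c)) \<and>
     (\<forall>c\<in>carrier C. tensor_map C C ground C \<epsilon> id (\<Delta> c) = tns ground C 1 c) \<and>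
     (\<forall>c\<in>carrier C. tensor_map C C C ground id \<epsilon> (\<Delta> c) = tns C ground c 1)"


section \<open>Algebras with enough idempotents\<close>

locale k_algebra = vector_space scale
  for scale :: "'k::field \<Rightarrow> 'a::ring \<Rightarrow> 'a" +
  assumes scale_mult_left: "scale c x * y = scale c (x * y)"
    and scale_mult_right: "x * scale c y = scale c (x * y)"

definition internal_direct_sum :: "'r set \<Rightarrow> ('r \<Rightarrow> 'a::ab_group_add set) \<Rightarrow> bool" where
  "internal_direct_sum R S \<longleftrightarrow>
     (\<forall>x. \<exists>!g. (\<forall>\<alpha>\<in>R. g \<alpha> \<in> S \<alpha>) \<and> (\<forall>\<alpha>. \<alpha> \<notin> R \<longrightarrow> g \<alpha> = 0) \<and>
        finite {\<alpha>. g \<alpha> \<noteq> 0} \<and> x = (\<Sum>\<alpha>\<in>{\<alpha>. g \<alpha> \<noteq> 0}. g \<alpha>))"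

locale algebra_enough_idempotents = k_algebra scale
  for scale :: "'k::field \<Rightarrow> 'a::ring \<Rightarrow> 'a" +
  fixes R :: "'r set" and e :: "'r \<Rightarrow> 'a"
  assumes idempotent: "\<alpha> \<in> R \<Longrightarrow> e \<alpha> * e \<alpha> = e \<alpha>"
    and orthogonal: "\<alpha> \<in> R \<Longrightarrow> \<beta> \<in> R \<Longrightarrow> \<alpha> \<noteq> \<beta> \<Longrightarrow> e \<alpha> * e \<beta> = 0"
    and left_sum: "internal_direct_sum R (\<lambda>\<alpha>. {a * e \<alpha> | a. True})"
    and right_sum: "internal_direct_sum R (\<lambda>\<alpha>. {e \<alpha> * a | a. True})"


section \<open>The finite dual\<close>

definition alg_space :: "('k::field \<Rightarrow> 'a::ring \<Rightarrow> 'a) \<Rightarrow> ('k, 'a) vsp" where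
  "alg_space scale = \<lparr>carrier = UNIV, scal = scale\<rparr>"

definition two_sided_ideal :: "('k::field \<Rightarrow> 'a::ring \<Rightarrow> 'a) \<Rightarrow> 'a set \<Rightarrow> bool" where
  "two_sided_ideal scale I \<longleftrightarrow>
     module.subspace scale I \<and> (\<forall>a. \<forall>x\<in>I. a * x \<in> I \<and> x * a \<in> I)"

text \<open>The quotient by \<open>I\<close> is spanned by the classes of finitely many elements.\<close>

definition finite_codim :: "('k::field \<Rightarrow> 'a::ring \<Rightarrow> 'a) \<Rightarrow> 'a set \<Rightarrow> bool" where
  "finite_codim scale I \<longleftrightarrow>
     (\<exists>S. finite S \<and> (\<forall>x. \<exists>y\<in>module.span scale S. x - y \<in> I))"

definition finite_dual :: "('k::field \<Rightarrow> 'a::ring \<Rightarrow> 'a) \<Rightarrow> ('k, 'a \<Rightarrow> 'k) vsp" where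
  "finite_dual scale =
     \<lparr>carrier = {f \<in> carrier (dual (alg_space scale)).
        \<exists>I. two_sided_ideal scale I \<and> finite_codim scale I \<and> I \<subseteq> {x. f x = 0}},
      scal = fun_scale\<rparr>"

definition mult_map :: "('k::field \<Rightarrow> 'a::ring \<Rightarrow> 'a) \<Rightarrow> (('a \<Rightarrow> 'a \<Rightarrow> 'k) \<Rightarrow> 'k) \<Rightarrow> 'a" where
  "mult_map scale = tensor_lift (alg_space scale) (alg_space scale) (alg_space scale) (*)"

text \<open>The natural map \<open>\<psi>\<close> into the dual of \<open>A \<otimes> A\<close>, restricted to \<open>F \<otimes> F\<close> for a
  subspace \<open>F\<close> of the dual of \<open>A\<close>; it sends \<open>f \<otimes> g\<close> to the functional with
  \<open>x \<otimes> y \<mapsto> f x * g y\<close>.\<close>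

definition dual_tensor_map :: "('k::field \<Rightarrow> 'a::ring \<Rightarrow> 'a) \<Rightarrow> ('k, 'a \<Rightarrow> 'k) vsp \<Rightarrow>
    ((('a \<Rightarrow> 'k) \<Rightarrow> ('a \<Rightarrow> 'k) \<Rightarrow> 'k) \<Rightarrow> 'k) \<Rightarrow> (('a \<Rightarrow> 'a \<Rightarrow> 'k) \<Rightarrow> 'k) \<Rightarrow> 'k" where
  "dual_tensor_map scale F =
     tensor_lift F F (dual (tensor (alg_space scale) (alg_space scale)))
       (\<lambda>f g. tensor_lift (alg_space scale) (alg_space scale) ground (\<lambda>x y. f x * g y))"

text \<open>\<open>f \<circ> mult_map scale\<close> is the image of \<open>f\<close> under the dual of the multiplication; it
  vanishes outside \<open>A \<otimes> A\<close> because \<open>mult_map\<close> does.\<close>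

definition finite_dual_comult :: "('k::field \<Rightarrow> 'a::ring \<Rightarrow> 'a) \<Rightarrow>
    ('a \<Rightarrow> 'k) \<Rightarrow> (('a \<Rightarrow> 'k) \<Rightarrow> ('a \<Rightarrow> 'k) \<Rightarrow> 'k) \<Rightarrow> 'k" where
  "finite_dual_comult scale f =
     inv_into (carrier (tensor (finite_dual scale) (finite_dual scale)))
       (dual_tensor_map scale (finite_dual scale)) (f \<circ> mult_map scale)"

definition finite_dual_counit :: "'r set \<Rightarrow> ('r \<Rightarrow> 'a) \<Rightarrow> ('a \<Rightarrow> 'k::field) \<Rightarrow> 'k" where
  "finite_dual_counit R e f = (\<Sum>\<alpha>\<in>{\<alpha>\<in>R. f (e \<alpha>) \<noteq> 0}. f (e \<alpha>))"

end

theory Submission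
  imports Defs
begin

text \<open>
  Write \<open>F\<close> for the finite dual of \<open>A\<close>. The functionals \<open>f \<otimes> g \<mapsto> f x * g y\<close> separate the points
  of \<open>F \<otimes> F\<close>, and similarly for triple tensor products. Hence \<open>\<Delta> f\<close> is the unique tensor with
  \<open>\<Delta> f (x, y) = f (x * y)\<close>, and both sides of the coassociativity law take the value
  \<open>f (x * y * z)\<close> at \<open>(x, y, z)\<close>. For existence, let \<open>f\<close> vanish on an ideal \<open>I\<close> of finite codimension
  and choose finitely many \<open>t\<close> with coordinate functionals \<open>\<phi> t\<close> vanishing on \<open>I\<close> such that
  \<open>x - (\<Sum>t. \<phi> t x \<cdot> t) \<in> I\<close> for all \<open>x\<close>; then \<open>f (x * y) = (\<Sum>t. \<phi> t x * f (t * y))\<close>.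
  The counit laws reduce to \<open>x = (\<Sum>\<alpha>. e \<alpha> * x) = (\<Sum>\<alpha>. x * e \<alpha>)\<close> over any large enough finite
  set of indices.
\<close>

section \<open>Linear and bilinear maps\<close>

lemma lin_in: "lin V W f \<Longrightarrow> x \<in> carrier V \<Longrightarrow> f x \<in> carrier W"
  by (simp add: lin_def)

lemma lin_add: "lin V W f \<Longrightarrow> x \<in> carrier V \<Longrightarrow> y \<in> carrier V \<Longrightarrow> f (x + y) = f x + f y"
  by (simp add: lin_def)

lemma lin_scal: "lin V W f \<Longrightarrow> x \<in> carrier V \<Longrightarrow> f (scal V c x) = scal W c (f x)"
  by (simp add: lin_def)

lemma lin_id: "lin V V id"
  by (simp add: lin_def)

lemma lin_compose: "lin V W f \<Longrightarrow> lin W U g \<Longrightarrow> lin V U (\<lambda>x. g (f x))"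
  by (simp add: lin_def)

lemma lin_groundI:
  assumes "\<And>x y. x \<in> carrier V \<Longrightarrow> y \<in> carrier V \<Longrightarrow> f (x + y) = f x + f y"
    and "\<And>c x. x \<in> carrier V \<Longrightarrow> f (scal V c x) = c * f x"
  shows "lin V ground f"
  using assms by (simp add: lin_def ground_def)

lemma lin_ground_scal: "lin V ground f \<Longrightarrow> x \<in> carrier V \<Longrightarrow> f (scal V c x) = c * f x"
  by (simp add: lin_def ground_def)

lemma bilinI:
  assumes "\<And>v. v \<in> carrier V \<Longrightarrow> lin W U (B v)"
    and "\<And>w. w \<in> carrier W \<Longrightarrow> lin V U (\<lambda>v. B v w)"
  shows "bilin V W U B"
  using assms by (simp add: bilin_def)

lemma bilin_left: "bilin V W U B \<Longrightarrow> w \<in> carrier W \<Longrightarrow> lin V U (\<lambda>v. B v w)"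
  by (simp add: bilin_def)

lemma bilin_right: "bilin V W U B \<Longrightarrow> v \<in> carrier V \<Longrightarrow> lin W U (B v)"
  by (simp add: bilin_def)

lemma bilin_compose: "bilin V W U B \<Longrightarrow> lin U U' f \<Longrightarrow> bilin V W U' (\<lambda>v w. f (B v w))"
  by (simp add: bilin_def lin_def)

lemma bilin_compose2:
  assumes "lin V V' f" "lin W W' g" "bilin V' W' U B"
  shows "bilin V W U (\<lambda>v w. B (f v) (g w))"
  using assms by (simp add: bilin_def lin_def)

lemma bilin_mult:
  fixes p :: "'v::ab_group_add \<Rightarrow> 'k::field" and q :: "'w::ab_group_add \<Rightarrow> 'k"
  assumes "lin V ground p" "lin W ground q"
  shows "bilin V W ground (\<lambda>v w. p v * q w)"
  using assms by (auto simp: bilin_def lin_def ground_def algebra_simps)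

lemma vspace_scal: "vspace V \<Longrightarrow> vector_space (scal V)"
  and vspace_subspace: "vspace V \<Longrightarrow> module.subspace (scal V) (carrier V)"
  by (simp_all add: vspace_def)

context
  fixes V :: "('k::field, 'v::ab_group_add) vsp"
  assumes V: "vspace V"
begin

interpretation V: vector_space "scal V" by (rule vspace_scal[OF V])

lemma zero_closed: "0 \<in> carrier V"
  by (rule V.subspace_0[OF vspace_subspace[OF V]])

lemma add_closed: "x \<in> carrier V \<Longrightarrow> y \<in> carrier V \<Longrightarrow> x + y \<in> carrier V"
  by (rule V.subspace_add[OF vspace_subspace[OF V]])

lemma scal_closed: "x \<in> carrier V \<Longrightarrow> scal V c x \<in> carrier V"
  by (rule V.subspace_scale[OF vspace_subspace[OF V]])

lemma lin_zero:
  assumes "lin V W f"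
  shows "f 0 = 0"
  using lin_add[OF assms zero_closed zero_closed] by simp

lemma sum_closed: "(\<And>i. i \<in> S \<Longrightarrow> x i \<in> carrier V) \<Longrightarrow> sum x S \<in> carrier V"
  by (rule V.subspace_sum[OF vspace_subspace[OF V]])

lemma lin_sum:
  assumes "lin V W f" "\<And>i. i \<in> S \<Longrightarrow> x i \<in> carrier V"
  shows "f (sum x S) = (\<Sum>i\<in>S. f (x i))"
  using assms(2)
\<comment> \<open>A sum over an infinite set is 0 by convention, so that case rests on
  \<open>lin_zero\<close> like the empty one.\<close>
proof (induction S rule: infinite_finite_induct)
  case (insert i S)
  then show ?case
    using lin_add[OF assms(1), of "x i" "sum x S"] sum_closed[of S x] by simp
qed (simp_all add: lin_zero[OF assms(1)])

end

lemma vspace_ground: "vspace (ground :: ('k::field, 'k) vsp)"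
proof -
  interpret vector_space "(*) :: 'k \<Rightarrow> 'k \<Rightarrow> 'k"
    by unfold_locales (auto simp: algebra_simps)
  have "vector_space ((*) :: 'k \<Rightarrow> 'k \<Rightarrow> 'k)" ..
  then show ?thesis by (simp add: vspace_def ground_def)
qed

lemma vspace_dual: "vspace (dual (V :: ('k::field, 'v::ab_group_add) vsp))"
proof -
  interpret vector_space "fun_scale :: 'k \<Rightarrow> ('v \<Rightarrow> 'k) \<Rightarrow> _" by (rule vector_space_fun_scale)
  show ?thesis
    by (auto simp: vspace_def dual_def vector_space_fun_scale subspace_def lin_def ground_def
        fun_scale_def algebra_simps)
qed

section \<open>Tensor products\<close>

lemma scal_tensor: "scal (tensor V W) = fun_scale"
  by (simp add: tensor_def)

section \<open>Values of tensors at bilinear forms\<close>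

lemma lin_cong:
  assumes "vspace V" "\<And>v. v \<in> carrier V \<Longrightarrow> f v = g v"
  shows "lin V W f \<longleftrightarrow> lin V W g"
  using assms(2) add_closed[OF assms(1)] scal_closed[OF assms(1)] by (simp add: lin_def)

text \<open>Bilinearity speaks only of arguments in the carriers, and these are closed under the
  operations.\<close>

lemma bilin_cong:
  assumes "vspace V" "vspace W"
    and "\<And>v w. v \<in> carrier V \<Longrightarrow> w \<in> carrier W \<Longrightarrow> B v w = B' v w"
  shows "bilin V W U B \<longleftrightarrow> bilin V W U B'"
  using assms add_closed[OF assms(1)] add_closed[OF assms(2)]
    scal_closed[OF assms(1)] scal_closed[OF assms(2)]
  by (simp add: bilin_def lin_def)

text \<open>A tensor is a function on all of \<open>'v \<Rightarrow> 'w \<Rightarrow> 'k\<close>, but it only sees the restriction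
  of a form to the carriers.\<close>

lemma tensor_apply_cong:
  fixes V :: "('k::field, 'v::ab_group_add) vsp" and W :: "('k, 'w::ab_group_add) vsp"
  assumes "vspace V" "vspace W" "t \<in> carrier (tensor V W)"
    and "\<And>v w. v \<in> carrier V \<Longrightarrow> w \<in> carrier W \<Longrightarrow> \<beta> v w = \<beta>' v w"
  shows "t \<beta> = t \<beta>'"
  using assms(3)
proof (induction rule: tensor_induct)
  case (step c v w t)
  then show ?case
    using bilin_cong[OF assms(1,2,4), where U = ground] assms(4)
    by (simp add: fun_scale_def tns_def)
qed simp

text \<open>Each \<open>tns V W v w\<close> is 0 at such a form by definition, and this passes to
  the span. Equality of tensors can therefore be checked at bilinear forms.\<close>

lemma tensor_apply_non_bilin:
  assumes "t \<in> carrier (tensor V W)" "\<not> bilin V W ground \<beta>"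
  shows "t \<beta> = 0"
  using assms(1) by (induction rule: tensor_induct) (simp_all add: fun_scale_def tns_def assms(2))

lemma lin_tensor_apply: "lin (tensor V W) ground (\<lambda>t. t \<beta>)"
  by (rule lin_groundI) (simp_all add: scal_tensor fun_scale_def)

text \<open>Checked pointwise: at a bilinear form the laws are those of the form itself, at any
  other form all values are 0.\<close>

lemma bilin_tns:
  fixes V :: "('k::field, 'v::ab_group_add) vsp" and W :: "('k, 'w::ab_group_add) vsp"
  assumes "vspace V" "vspace W"
  shows "bilin V W (tensor V W) (tns V W)"
proof -
  have "\<beta> (v + v') w = \<beta> v w + \<beta> v' w" "\<beta> (scal V c v) w = c * \<beta> v w"
    "\<beta> v (w + w') = \<beta> v w + \<beta> v w'" "\<beta> v (scal W c w) = c * \<beta> v w"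
    if "bilin V W ground \<beta>" "v \<in> carrier V" "v' \<in> carrier V" "w \<in> carrier W" "w' \<in> carrier W"
    for \<beta> v v' w w' c
    using that by (simp_all add: bilin_def lin_def ground_def)
  then show ?thesis
    by (simp add: bilin_def[of _ _ "tensor V W"] lin_def scal_tensor tns_in_tensor)
      (simp add: tns_def fun_scale_def fun_eq_iff)
qed

section \<open>The universal property and induced maps\<close>

text \<open>The definite description in \<open>tensor_lift\<close> denotes: existence is
  \<open>tensor_lift_exists\<close>; for uniqueness, \<open>tensor_lift_unique\<close> settles the
  tensors and the default value 0 settles all other arguments.\<close>

lemma tensor_lift:
  fixes V :: "('k::field, 'v::ab_group_add) vsp" and W :: "('k, 'w::ab_group_add) vsp"
    and U :: "('k, 'u::ab_group_add) vsp"
  assumes U: "vspace U" and B: "bilin V W U B"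
  shows lin_tensor_lift: "lin (tensor V W) U (tensor_lift V W U B)"
    and tensor_lift_tns: "v \<in> carrier V \<Longrightarrow> w \<in> carrier W \<Longrightarrow> tensor_lift V W U B (tns V W v w) = B v w"
    and tensor_lift_outside: "t \<notin> carrier (tensor V W) \<Longrightarrow> tensor_lift V W U B t = 0"
proof -
  let ?P = "\<lambda>L. lin (tensor V W) U L \<and>
     (\<forall>v\<in>carrier V. \<forall>w\<in>carrier W. L (tns V W v w) = B v w) \<and>
     (\<forall>t. t \<notin> carrier (tensor V W) \<longrightarrow> L t = 0)"
  have "\<exists>!L. ?P L"
  proof (rule ex_ex1I[OF tensor_lift_exists[OF assms]])
    fix L L' assume L: "?P L" "?P L'"
    show "L = L'"
    proof
      fix t show "L t = L' t"
        using L tensor_lift_unique[of V W U L L' t] U by (cases "t \<in> carrier (tensor V W)") auto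
    qed
  qed
  then have *: "?P (tensor_lift V W U B)" unfolding tensor_lift_def by (rule theI')
  show "lin (tensor V W) U (tensor_lift V W U B)"
    and "v \<in> carrier V \<Longrightarrow> w \<in> carrier W \<Longrightarrow> tensor_lift V W U B (tns V W v w) = B v w"
    and "t \<notin> carrier (tensor V W) \<Longrightarrow> tensor_lift V W U B t = 0"
    using * by blast+
qed

text \<open>Induction on \<open>t\<close>: a generator contributes \<open>B w u v\<close>, which is
  linear in \<open>w\<close>, and linear combinations of linear maps are linear. This yields
  bilinearity of maps that are themselves defined by lifting, namely in the associativity map and in
  the natural map into the dual of \<open>A \<otimes> A\<close>.\<close>

lemma lin_tensor_lift_parameter:
  fixes U :: "('k::field, 'u::ab_group_add) vsp" and V :: "('k, 'v::ab_group_add) vsp"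
    and W :: "('k, 'w::ab_group_add) vsp" and X :: "('k, 'x::ab_group_add) vsp"
  assumes W: "vspace W" and X: "vspace X"
    and B: "\<And>w. w \<in> carrier W \<Longrightarrow> bilin U V X (B w)"
    and lin: "\<And>u v. u \<in> carrier U \<Longrightarrow> v \<in> carrier V \<Longrightarrow> lin W X (\<lambda>w. B w u v)"
    and t: "t \<in> carrier (tensor U V)"
  shows "lin W X (\<lambda>w. tensor_lift U V X (B w) t)"
  using t
proof (induction rule: tensor_induct)
  interpret X: vector_space "scal X" by (rule vspace_scal[OF X])
  case base
  have "lin W X (\<lambda>w. 0)" using zero_closed[OF X] by (simp add: lin_def)
  moreover have "tensor_lift U V X (B w) 0 = 0" if "w \<in> carrier W" for w
    by (rule lin_zero[OF vspace_tensor lin_tensor_lift[OF X B[OF that]]])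
  \<comment> \<open>\<open>B w\<close> is known to be bilinear only for \<open>w\<close> in the
    carrier, so the identity holds only there and is transferred by \<open>lin_cong\<close>.\<close>
  ultimately show ?case by (rule lin_cong[OF W, THEN iffD2, rotated])
next
  interpret X: vector_space "scal X" by (rule vspace_scal[OF X])
  case (step c u v t)
  have "lin W X (\<lambda>w. scal X c (B w u v) + tensor_lift U V X (B w) t)"
    using lin[OF step(1,2)] step.IH add_closed[OF X] scal_closed[OF X]
    by (simp add: lin_def X.scale_right_distrib X.scale_left_commute algebra_simps)
  moreover have "tensor_lift U V X (B w) (fun_scale c (tns U V u v) + t)
      = scal X c (B w u v) + tensor_lift U V X (B w) t" if w: "w \<in> carrier W" for w
  proof -
    note L = lin_tensor_lift[OF X B[OF w]]
    have uv: "tns U V u v \<in> carrier (tensor U V)" by (rule tns_in_tensor[OF step(1,2)])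
    show ?thesis
      using lin_add[OF L scal_closed[OF vspace_tensor uv] step(3)] lin_scal[OF L uv]
        tensor_lift_tns[OF X B[OF w] step(1,2)] by (simp add: scal_tensor)
  qed
  ultimately show ?case by (rule lin_cong[OF W, THEN iffD2, rotated])
qed

text \<open>Both sides are linear in \<open>t\<close> and agree on generators. This is the
  computation rule for lifts: under a functional \<open>p\<close>, a lift becomes evaluation of
  \<open>t\<close> at a bilinear form.\<close>

lemma functional_tensor_lift:
  fixes V :: "('k::field, 'v::ab_group_add) vsp" and W :: "('k, 'w::ab_group_add) vsp"
    and U :: "('k, 'u::ab_group_add) vsp"
  assumes U: "vspace U" and B: "bilin V W U B" and p: "lin U ground p"
    and t: "t \<in> carrier (tensor V W)"
  shows "p (tensor_lift V W U B t) = t (\<lambda>v w. p (B v w))"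
  by (rule tensor_lift_unique[OF lin_compose[OF lin_tensor_lift[OF U B] p]
        lin_tensor_apply vspace_ground _ t])
    (simp add: tensor_lift_tns[OF U B], simp add: tns_def bilin_compose[OF B p])

lemma tensor_lift_ground:
  assumes "bilin V W ground \<beta>"
  shows "tensor_lift V W ground \<beta> = (\<lambda>t. if t \<in> carrier (tensor V W) then t \<beta> else 0)"
  using functional_tensor_lift[OF vspace_ground assms lin_id]
    tensor_lift_outside[OF vspace_ground assms] by (auto simp: fun_eq_iff)

lemma bilin_tensor_map:
  assumes "vspace V'" "vspace W'" "lin V V' f" "lin W W' g"
  shows "bilin V W (tensor V' W') (\<lambda>v w. tns V' W' (f v) (g w))"
  by (rule bilin_compose2[OF assms(3,4) bilin_tns[OF assms(1,2)]])

lemma lin_tensor_map: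
  assumes "vspace V'" "vspace W'" "lin V V' f" "lin W W' g"
  shows "lin (tensor V W) (tensor V' W') (tensor_map V W V' W' f g)"
  unfolding tensor_map_def by (rule lin_tensor_lift[OF vspace_tensor bilin_tensor_map[OF assms]])

lemma functional_tensor_map:
  fixes V :: "('k::field, 'v::ab_group_add) vsp" and W :: "('k, 'w::ab_group_add) vsp"
  assumes "vspace V'" "vspace W'" "lin V V' f" "lin W W' g"
    and "lin (tensor V' W') ground p" "t \<in> carrier (tensor V W)"
  shows "p (tensor_map V W V' W' f g t) = t (\<lambda>v w. p (tns V' W' (f v) (g w)))"
  unfolding tensor_map_def
  by (rule functional_tensor_lift[OF vspace_tensor bilin_tensor_map[OF assms(1-4)] assms(5,6)])

section \<open>Finite expansions of tensors and separation of points\<close>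

lemma tensor_sum_exists:
  fixes V :: "('k::field, 'v::ab_group_add) vsp" and W :: "('k, 'w::ab_group_add) vsp"
  assumes "\<And>i. i \<in> S \<Longrightarrow> v i \<in> carrier V" "\<And>i. i \<in> S \<Longrightarrow> w i \<in> carrier W"
  obtains t where "t \<in> carrier (tensor V W)"
    and "\<And>\<beta>. bilin V W ground \<beta> \<Longrightarrow> t \<beta> = (\<Sum>i\<in>S. \<beta> (v i) (w i))"
proof
  let ?t = "\<Sum>i\<in>S. tns V W (v i) (w i)"
  have in_t: "\<And>i. i \<in> S \<Longrightarrow> tns V W (v i) (w i) \<in> carrier (tensor V W)"
    using assms by (rule tns_in_tensor)
  then show "?t \<in> carrier (tensor V W)" by (rule sum_closed[OF vspace_tensor])
  fix \<beta> assume "bilin V W ground \<beta>"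
  then show "?t \<beta> = (\<Sum>i\<in>S. \<beta> (v i) (w i))"
    using lin_sum[OF vspace_tensor lin_tensor_apply[where \<beta> = \<beta>] in_t] by (simp add: tns_def)
qed

text \<open>Induction on \<open>t\<close>: the second factor of a new generator is expanded over
  \<open>B\<close> and its coefficients move to the first factor. \<open>B\<close> is any spanning
  set: a basis when points are separated, the whole carrier when just some finite expansion is
  wanted.\<close>

lemma tensor_basis_expansion:
  fixes V :: "('k::field, 'v::ab_group_add) vsp" and W :: "('k, 'w::ab_group_add) vsp"
  assumes V: "vspace V" and W: "vspace W" and t: "t \<in> carrier (tensor V W)"
    and B: "B \<subseteq> carrier W" "carrier W \<subseteq> module.span (scal W) B"
  obtains S u where "finite S" "S \<subseteq> B" "\<And>b. u b \<in> carrier V"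
    and "\<And>\<beta>. bilin V W ground \<beta> \<Longrightarrow> t \<beta> = (\<Sum>b\<in>S. \<beta> (u b) b)"
proof -
  interpret W: vector_space "scal W" by (rule vspace_scal[OF W])
  interpret V: vector_space "scal V" by (rule vspace_scal[OF V])
  have "\<exists>S u. finite S \<and> S \<subseteq> B \<and> (\<forall>b. u b \<in> carrier V) \<and>
    (\<forall>\<beta>. bilin V W ground \<beta> \<longrightarrow> t \<beta> = (\<Sum>b\<in>S. \<beta> (u b) b))"
    using t
  proof (induction rule: tensor_induct)
    case base
    show ?case
      by (rule exI[of _ "{}"], rule exI[of _ "\<lambda>_. 0"]) (simp add: zero_closed[OF V])
  next
    case (step c v w t)
    then obtain S u where S: "finite S" "S \<subseteq> B" and u: "\<And>b. u b \<in> carrier V"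
      and eq: "\<And>\<beta>. bilin V W ground \<beta> \<Longrightarrow> t \<beta> = (\<Sum>b\<in>S. \<beta> (u b) b)"
      by auto
    from step(2) B(2) obtain S' r where S': "finite S'" "S' \<subseteq> B" and w: "w = (\<Sum>b\<in>S'. scal W (r b) b)"
      unfolding W.span_explicit by blast
    \<comment> \<open>The first summand is the contribution of the new generator with the
      coefficients \<open>r b\<close> of \<open>w\<close> moved onto \<open>v\<close>, the second
      that of the old expansion; both are present where \<open>S'\<close> and \<open>S\<close>
      overlap.\<close>
    let ?u = "\<lambda>b. (if b \<in> S' then scal V (c * r b) v else 0) + (if b \<in> S then u b else 0)"
    show ?case
    proof (rule exI[of _ "S' \<union> S"], rule exI[of _ ?u], intro conjI allI impI)
      show "?u b \<in> carrier V" for b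
        using step(1) u zero_closed[OF V] by (auto intro!: add_closed[OF V] scal_closed[OF V])
      fix \<beta> assume \<beta>: "bilin V W ground \<beta>"
      have "\<beta> (?u b) b = (if b \<in> S' then c * r b * \<beta> v b else 0) + (if b \<in> S then \<beta> (u b) b else 0)"
        if "b \<in> S' \<union> S" for b
      proof -
        have l: "lin V ground (\<lambda>v. \<beta> v b)"
          using that S S' B(1) by (intro bilin_left[OF \<beta>]) auto
        have sc: "\<beta> (scal V (c * r b) v) b = c * r b * \<beta> v b"
          using lin_ground_scal[OF l step(1)] .
        have "\<beta> (?u b) b = \<beta> (if b \<in> S' then scal V (c * r b) v else 0) b
            + \<beta> (if b \<in> S then u b else 0) b"
          using step(1) u by (intro lin_add[OF l]) (auto intro: zero_closed[OF V] scal_closed[OF V])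
        then show ?thesis using sc lin_zero[OF V l] by (simp split: if_splits)
      qed
      then have "(\<Sum>b\<in>S'\<union>S. \<beta> (?u b) b) = (\<Sum>b\<in>S'\<union>S. if b \<in> S' then c * r b * \<beta> v b else 0)
          + (\<Sum>b\<in>S'\<union>S. if b \<in> S then \<beta> (u b) b else 0)"
        by (simp add: sum.distrib)
      also have "\<dots> = (\<Sum>b\<in>S'. c * r b * \<beta> v b) + (\<Sum>b\<in>S. \<beta> (u b) b)"
        using S(1) S'(1) by (simp flip: sum.inter_restrict)
      also have "(\<Sum>b\<in>S'. c * r b * \<beta> v b) = c * \<beta> v w"
      proof -
        have r: "lin W ground (\<beta> v)" by (rule bilin_right[OF \<beta> step(1)])
        have inW: "b \<in> carrier W" if "b \<in> S'" for b using that S'(2) B(1) by auto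
        have "\<beta> v w = (\<Sum>b\<in>S'. \<beta> v (scal W (r b) b))"
          unfolding w by (intro lin_sum[OF W r] scal_closed[OF W] inW)
        also have "\<dots> = (\<Sum>b\<in>S'. r b * \<beta> v b)"
          by (intro sum.cong refl lin_ground_scal[OF r] inW)
        finally show ?thesis by (simp add: sum_distrib_left mult.assoc)
      qed
      finally show "(fun_scale c (tns V W v w) + t) \<beta> = (\<Sum>b\<in>S'\<union>S. \<beta> (?u b) b)"
        using \<beta> eq[OF \<beta>] by (simp add: fun_scale_def tns_def)
    qed (use S S' in auto)
  qed
  then show ?thesis
    by (elim exE conjE) (rule that, assumption, assumption, erule spec, simp only:)
qed

text \<open>Expand the difference as \<open>\<Sum>b. u b \<otimes> b\<close> over a basis of \<open>W\<close>. Each \<open>\<Sum>b. p i (u b) \<cdot> b\<close> is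
  annihilated by all \<open>q j\<close>, so every \<open>p i (u b)\<close> vanishes.\<close>

lemma tensor_functionals_separate:
  fixes V :: "('k::field, 'v::ab_group_add) vsp" and W :: "('k, 'w::ab_group_add) vsp"
  assumes V: "vspace V" and W: "vspace W"
    and P: "\<And>i. lin V ground (p i)" "\<And>v. v \<in> carrier V \<Longrightarrow> (\<And>i. p i v = 0) \<Longrightarrow> v = 0"
    and Q: "\<And>j. lin W ground (q j)" "\<And>w. w \<in> carrier W \<Longrightarrow> (\<And>j. q j w = 0) \<Longrightarrow> w = 0"
    and st: "s \<in> carrier (tensor V W)" "t \<in> carrier (tensor V W)"
    and eq: "\<And>i j. s (\<lambda>v w. p i v * q j w) = t (\<lambda>v w. p i v * q j w)"
  shows "s = t"
proof -
  interpret W: vector_space "scal W" by (rule vspace_scal[OF W])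
  interpret T: vector_space "scal (tensor V W)" by (rule vspace_scal[OF vspace_tensor])
  obtain B where B: "B \<subseteq> carrier W" "W.independent B" "carrier W \<subseteq> W.span B"
    by (rule W.basis_exists)
  let ?d = "s - t"
  have d: "?d \<in> carrier (tensor V W)"
    by (rule T.subspace_diff[OF vspace_subspace[OF vspace_tensor] st])
  obtain S u where S: "finite S" "S \<subseteq> B" and u: "\<And>b. u b \<in> carrier V"
    and exp: "\<And>\<beta>. bilin V W ground \<beta> \<Longrightarrow> ?d \<beta> = (\<Sum>b\<in>S. \<beta> (u b) b)"
    by (rule tensor_basis_expansion[OF V W d B(1,3)], rule that)
  have inW: "b \<in> carrier W" if "b \<in> S" for b using that S B by auto
  have "p i (u b) = 0" if b: "b \<in> S" for i b
  proof -
    let ?w = "\<Sum>b\<in>S. scal W (p i (u b)) b"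
    have "?w = 0"
    proof (rule Q(2))
      show "?w \<in> carrier W" by (intro sum_closed[OF W] scal_closed[OF W] inW)
      fix j
      have "q j ?w = (\<Sum>b\<in>S. q j (scal W (p i (u b)) b))"
        by (intro lin_sum[OF W Q(1)] scal_closed[OF W] inW)
      also have "\<dots> = (\<Sum>b\<in>S. p i (u b) * q j b)"
        by (intro sum.cong refl lin_ground_scal[OF Q(1)] inW)
      also have "\<dots> = ?d (\<lambda>v w. p i v * q j w)" by (rule exp[OF bilin_mult[OF P(1) Q(1)], symmetric])
      also have "\<dots> = 0" using eq by simp
      finally show "q j ?w = 0" .
    qed
    then show ?thesis by (rule W.independentD[OF B(2) S _ b])
  qed
  then have u0: "u b = 0" if "b \<in> S" for b using that by (intro P(2)[OF u])
  have "?d \<beta> = 0" for \<beta>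
  proof (cases "bilin V W ground \<beta>")
    case True
    have "\<beta> (u b) b = 0" if "b \<in> S" for b
      using lin_zero[OF V bilin_left[OF True inW[OF that]]] u0[OF that] by simp
    then show ?thesis unfolding exp[OF True] by (intro sum.neutral ballI)
  qed (rule tensor_apply_non_bilin[OF d])
  then have "s \<beta> = t \<beta>" for \<beta> by (metis fun_diff_def right_minus_eq)
  then show "s = t" by (rule ext)
qed


section \<open>Associativity of the tensor product\<close>

text \<open>The two nested lifts in \<open>tensor_assoc\<close> are legitimate: the inner one for
  each fixed \<open>w\<close>, then the outer one, whose linearity in \<open>w\<close> is linearity
  of a lift in a parameter.\<close>

lemma bilin_assoc:
  fixes U :: "('k::field, 'u::ab_group_add) vsp" and V :: "('k, 'v::ab_group_add) vsp"
    and W :: "('k, 'w::ab_group_add) vsp"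
  assumes U: "vspace U" and V: "vspace V" and W: "vspace W"
  shows bilin_assoc_inner: "w \<in> carrier W \<Longrightarrow>
      bilin U V (tensor U (tensor V W)) (\<lambda>u v. tns U (tensor V W) u (tns V W v w))"
    and bilin_assoc_outer: "bilin (tensor U V) W (tensor U (tensor V W))
      (\<lambda>t w. tensor_lift U V (tensor U (tensor V W)) (\<lambda>u v. tns U (tensor V W) u (tns V W v w)) t)"
proof -
  note T = bilin_tns[OF U vspace_tensor[of V W]]
  note VW = bilin_tns[OF V W]
  show inner: "bilin U V (tensor U (tensor V W)) (\<lambda>u v. tns U (tensor V W) u (tns V W v w))"
    if "w \<in> carrier W" for w
    using bilin_compose2[OF lin_id bilin_left[OF VW that] T] by simp
  show "bilin (tensor U V) W (tensor U (tensor V W))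
      (\<lambda>t w. tensor_lift U V (tensor U (tensor V W)) (\<lambda>u v. tns U (tensor V W) u (tns V W v w)) t)"
  proof (rule bilinI)
    fix t assume "t \<in> carrier (tensor U V)"
    then show "lin W (tensor U (tensor V W))
      (\<lambda>w. tensor_lift U V (tensor U (tensor V W)) (\<lambda>u v. tns U (tensor V W) u (tns V W v w)) t)"
      by (intro lin_tensor_lift_parameter[OF W vspace_tensor inner]
          lin_compose[OF bilin_right[OF VW] bilin_right[OF T]])
  next
    fix w assume w: "w \<in> carrier W"
    show "lin (tensor U V) (tensor U (tensor V W))
      (tensor_lift U V (tensor U (tensor V W)) (\<lambda>u v. tns U (tensor V W) u (tns V W v w)))"
      by (rule lin_tensor_lift[OF vspace_tensor inner[OF w]])
  qed
qed

lemma lin_tensor_assoc: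
  assumes "vspace U" "vspace V" "vspace W"
  shows "lin (tensor (tensor U V) W) (tensor U (tensor V W)) (tensor_assoc U V W)"
  unfolding tensor_assoc_def by (rule lin_tensor_lift[OF vspace_tensor bilin_assoc_outer[OF assms]])

text \<open>Generators of the outer product suffice for coassociativity, since
  \<open>functional_tensor_map\<close> reduces the iterated map to them.\<close>

lemma functional_tensor_assoc_tns:
  fixes U :: "('k::field, 'u::ab_group_add) vsp" and V :: "('k, 'v::ab_group_add) vsp"
    and W :: "('k, 'w::ab_group_add) vsp"
  assumes "vspace U" "vspace V" "vspace W" "lin (tensor U (tensor V W)) ground p"
    and "t \<in> carrier (tensor U V)" "w \<in> carrier W"
  shows "p (tensor_assoc U V W (tns (tensor U V) W t w))
    = t (\<lambda>u v. p (tns U (tensor V W) u (tns V W v w)))"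
  unfolding tensor_assoc_def tensor_lift_tns[OF vspace_tensor bilin_assoc_outer[OF assms(1-3)] assms(5,6)]
  by (rule functional_tensor_lift[OF vspace_tensor bilin_assoc_inner[OF assms(1-3,6)] assms(4,5)])

section \<open>The finite dual\<close>

context k_algebra
begin

abbreviation A where "A \<equiv> alg_space scale"
abbreviation F where "F \<equiv> finite_dual scale"

lemma carrier_A [simp]: "carrier A = UNIV" and scal_A [simp]: "scal A = scale"
  by (simp_all add: alg_space_def)

lemma vspace_A: "vspace A"
  by (simp add: vspace_def vector_space_axioms)

section \<open>Subspaces of finite codimension\<close>

text \<open>Extend a basis \<open>B0\<close> of \<open>I\<close> to a basis \<open>B\<close> of the
  algebra. Coordinates along \<open>B - B0\<close> vanish on \<open>I\<close>, and it is enough to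
  keep the finitely many that occur in a finite set spanning modulo \<open>I\<close>.\<close>

lemma finite_codim_coordinates:
  assumes I: "subspace I" and fin: "finite_codim scale I"
  obtains T \<phi> where "finite T" "\<And>t. lin A ground (\<phi> t)" "\<And>t x. x \<in> I \<Longrightarrow> \<phi> t x = 0"
    and "\<And>x. x - (\<Sum>t\<in>T. scale (\<phi> t x) t) \<in> I"
proof -
  obtain S where S: "finite S" and dec: "\<And>x. \<exists>y\<in>span S. x - y \<in> I"
    using fin unfolding finite_codim_def by blast
  obtain B0 where B0: "B0 \<subseteq> I" "independent B0" "I \<subseteq> span B0"
    by (rule basis_exists)
  define B where "B = extend_basis B0"
  have B: "independent B" "span B = UNIV" "B0 \<subseteq> B"
    using independent_extend_basis[OF B0(2)] span_extend_basis[OF B0(2)] extend_basis_superset[OF B0(2)]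
    by (simp_all add: B_def)
  define \<phi> where "\<phi> b x = (if b \<in> B0 then 0 else representation B x b)" for b x
  define T where "T = (\<Union>s\<in>S. {b. representation B s b \<noteq> 0}) - B0"
  \<comment> \<open>All values of \<open>r\<close> lie in \<open>I\<close>: it is linear, fixes
    \<open>I\<close> pointwise and sends \<open>S\<close> into \<open>I\<close>, and every element
    is a sum of one from \<open>I\<close> and one from \<open>span S\<close>.\<close>
  define r where "r x = x - (\<Sum>t\<in>T. scale (\<phi> t x) t)" for x
  have fT: "finite T" unfolding T_def using S by (intro finite_Diff finite_UN_I finite_representation)
  have lin: "lin A ground (\<phi> t)" for t
    by (rule lin_groundI)
      (simp_all add: \<phi>_def representation_add representation_scale B(1,2))
  have van: "\<phi> t x = 0" if "x \<in> I" for t x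
  proof -
    have "representation B x = representation B0 x"
      by (rule representation_extend) (use that B0 B in auto)
    then show ?thesis using representation_ne_zero[of B0 x t] by (auto simp: \<phi>_def)
  qed
  have \<phi>_add: "\<phi> t (x + y) = \<phi> t x + \<phi> t y" and \<phi>_scale: "\<phi> t (scale c x) = c * \<phi> t x" for t x y c
    using lin_add[OF lin] lin_ground_scal[OF lin] by simp_all
  have r_add: "r (x + y) = r x + r y" for x y
    by (simp add: r_def \<phi>_add scale_left_distrib sum.distrib)
  have r_scale: "r (scale c x) = scale c (r x)" for c x
    by (simp add: r_def \<phi>_scale scale_right_diff_distrib scale_sum_right)
  have r_I: "r x = x" if "x \<in> I" for x using van[OF that] by (simp add: r_def)
  have r_S: "r s \<in> I" if s: "s \<in> S" for s
  proof -
    let ?D = "{b. representation B s b \<noteq> 0}"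
    have fD: "finite ?D" by (rule finite_representation)
    have "(\<Sum>t\<in>T. scale (\<phi> t s) t) = (\<Sum>b\<in>?D - B0. scale (\<phi> b s) b)"
      by (rule sum.mono_neutral_right) (use fT s in \<open>auto simp: T_def \<phi>_def\<close>)
    also have "\<dots> = (\<Sum>b\<in>?D - B0. scale (representation B s b) b)"
      by (rule sum.cong) (auto simp: \<phi>_def)
    finally have "(\<Sum>t\<in>T. scale (\<phi> t s) t) = (\<Sum>b\<in>?D - B0. scale (representation B s b) b)" .
    moreover have "s = (\<Sum>b\<in>?D. scale (representation B s b) b)"
      using sum_nonzero_representation_eq[of B s] B by simp
    moreover have "\<dots> = (\<Sum>b\<in>?D \<inter> B0. scale (representation B s b) b)
        + (\<Sum>b\<in>?D - B0. scale (representation B s b) b)"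
      by (rule sum.Int_Diff[OF fD])
    ultimately have "r s = (\<Sum>b\<in>?D \<inter> B0. scale (representation B s b) b)"
      unfolding r_def by (metis (no_types, lifting) add_diff_cancel_right')
    also have "\<dots> \<in> I"
      using B0(1) by (intro subspace_sum[OF I] subspace_scale[OF I]) auto
    finally show ?thesis .
  qed
  have r_span: "r y \<in> I" if "y \<in> span S" for y
    using that
  proof (induction rule: span_induct_alt)
    case base
    show ?case using r_I[OF subspace_0[OF I]] subspace_0[OF I] by simp
  next
    case (step c x y)
    then show ?case
      unfolding r_add r_scale by (intro subspace_add[OF I] subspace_scale[OF I] r_S[OF step(1)] step.IH)
  qed
  have "x - (\<Sum>t\<in>T. scale (\<phi> t x) t) \<in> I" for x
  proof -
    obtain y where y: "y \<in> span S" "x - y \<in> I" using dec by blast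
    have "r x = r (x - y) + r y" using r_add[of "x - y" y] by simp
    also have "\<dots> \<in> I" using r_I[OF y(2)] y(2) r_span[OF y(1)] by (simp add: subspace_add[OF I])
    finally show ?thesis by (simp add: r_def)
  qed
  then show ?thesis using that[of T \<phi>] fT lin van by blast
qed

text \<open>One functional is added at a time. If it vanishes on the common kernel of the others,
  the old \<open>S\<close> still works; otherwise a vector \<open>z\<close> of that kernel with
  nonzero value joins \<open>S\<close>.\<close>

lemma finite_spanning_modulo_kernels:
  assumes "finite \<Phi>" "\<And>\<phi>. \<phi> \<in> \<Phi> \<Longrightarrow> lin A ground \<phi>"
  shows "\<exists>S. finite S \<and> (\<forall>x. \<exists>y\<in>span S. \<forall>\<phi>\<in>\<Phi>. \<phi> (x - y) = 0)"
  using assms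
proof (induction \<Phi> rule: finite_induct)
  case empty
  show ?case by (rule exI[of _ "{}"]) auto
next
  case (insert \<phi> \<Phi>)
  have "\<exists>S. finite S \<and> (\<forall>x. \<exists>y\<in>span S. \<forall>\<phi>\<in>\<Phi>. \<phi> (x - y) = 0)"
    by (rule insert.IH) (simp add: insert.prems)
  then obtain S where S: "finite S" and dec: "\<And>x. \<exists>y\<in>span S. \<forall>\<phi>\<in>\<Phi>. \<phi> (x - y) = 0"
    by (elim exE conjE) simp
  have lin: "lin A ground \<chi>" if "\<chi> \<in> insert \<phi> \<Phi>" for \<chi> using insert.prems that by blast
  show ?case
  proof (cases "\<exists>z. (\<forall>\<chi>\<in>\<Phi>. \<chi> z = 0) \<and> \<phi> z \<noteq> 0")
    case False
    have "\<exists>y\<in>span S. \<forall>\<chi>\<in>insert \<phi> \<Phi>. \<chi> (x - y) = 0" for x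
    proof -
      obtain y where y: "y \<in> span S" "\<forall>\<chi>\<in>\<Phi>. \<chi> (x - y) = 0" by (rule bexE[OF dec])
      then have "\<phi> (x - y) = 0" using False by (metis (no_types))
      then show ?thesis using y by (intro bexI[of _ y]) simp_all
    qed
    then show ?thesis using S by (intro exI[of _ S]) simp
  next
    case True
    then obtain z where z: "\<forall>\<chi>\<in>\<Phi>. \<chi> z = 0" "\<phi> z \<noteq> 0" by (elim exE conjE) (rule that)
    show ?thesis
    proof (rule exI[of _ "insert z S"], intro conjI allI)
      fix x
      obtain y where y: "y \<in> span S" "\<forall>\<chi>\<in>\<Phi>. \<chi> (x - y) = 0" by (rule bexE[OF dec])
      \<comment> \<open>Subtracting this multiple of \<open>z\<close> kills the value of
        \<open>\<phi>\<close> and leaves the values of the functionals in \<open>\<Phi>\<close>,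
        which vanish at \<open>z\<close>, unchanged.\<close>
      define c where "c = \<phi> (x - y) / \<phi> z"
      have "y + scale c z \<in> span (insert z S)"
        using y(1) span_mono[of S "insert z S"] by (intro span_add span_scale) (auto intro: span_base)
      moreover have "\<forall>\<chi>\<in>insert \<phi> \<Phi>. \<chi> (x - (y + scale c z)) = 0"
      proof
        fix \<chi> assume \<chi>: "\<chi> \<in> insert \<phi> \<Phi>"
        have "\<chi> (x - y) = \<chi> (x - (y + scale c z)) + c * \<chi> z"
          using lin_add[OF lin[OF \<chi>], of "x - (y + scale c z)" "scale c z"]
            lin_ground_scal[OF lin[OF \<chi>], of z c] by simp
        moreover have "\<chi> (x - y) = c * \<chi> z"
          using \<chi>
        proof (rule insertE)
          assume "\<chi> \<in> \<Phi>"
          then have "\<chi> (x - y) = 0" "\<chi> z = 0" by (rule bspec[OF y(2)], rule bspec[OF z(1)])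
          then show ?thesis by simp
        qed (use z(2) in \<open>simp add: c_def\<close>)
        ultimately show "\<chi> (x - (y + scale c z)) = 0" by simp
      qed
      ultimately show "\<exists>y\<in>span (insert z S). \<forall>\<chi>\<in>insert \<phi> \<Phi>. \<chi> (x - y) = 0"
        by (rule bexI[rotated])
    qed (use S in simp)
  qed
qed

text \<open>An element at which all coordinate functionals of \<open>I\<close> and of
  \<open>J\<close> vanish equals its remainder, hence lies in both. So it suffices to span modulo
  the common kernel of finitely many functionals.\<close>

lemma finite_codim_Int:
  assumes "subspace I" "finite_codim scale I" "subspace J" "finite_codim scale J"
  shows "finite_codim scale (I \<inter> J)"
proof -
  obtain T \<phi> where T: "finite T" "\<And>t. lin A ground (\<phi> t)"
    "\<And>x. x - (\<Sum>t\<in>T. scale (\<phi> t x) t) \<in> I"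
    using finite_codim_coordinates[OF assms(1,2)] by metis
  obtain T' \<phi>' where T': "finite T'" "\<And>t. lin A ground (\<phi>' t)"
    "\<And>x. x - (\<Sum>t\<in>T'. scale (\<phi>' t x) t) \<in> J"
    using finite_codim_coordinates[OF assms(3,4)] by metis
  obtain S where S: "finite S" and dec: "\<And>x. \<exists>y\<in>span S. \<forall>\<chi>\<in>\<phi> ` T \<union> \<phi>' ` T'. \<chi> (x - y) = 0"
    using finite_spanning_modulo_kernels[of "\<phi> ` T \<union> \<phi>' ` T'"] T(1,2) T'(1,2) by blast
  have "z \<in> I \<inter> J" if "\<forall>\<chi>\<in>\<phi> ` T \<union> \<phi>' ` T'. \<chi> z = 0" for z
  proof -
    have "(\<Sum>t\<in>T. scale (\<phi> t z) t) = 0" "(\<Sum>t\<in>T'. scale (\<phi>' t z) t) = 0"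
      using that by (auto intro!: sum.neutral)
    then show ?thesis using T(3)[of z] T'(3)[of z] by simp
  qed
  then have "\<exists>y\<in>span S. x - y \<in> I \<inter> J" for x using dec[of x] by (elim bexE) (rule bexI)
  then show ?thesis using S unfolding finite_codim_def by (intro exI[of _ S]) simp
qed

section \<open>The finite dual as a vector space\<close>

lemma finite_dual_iff:
  "f \<in> carrier F \<longleftrightarrow> lin A ground f \<and>
    (\<exists>I. two_sided_ideal scale I \<and> finite_codim scale I \<and> (\<forall>x\<in>I. f x = 0))"
  by (auto simp: finite_dual_def dual_def subset_eq)

lemma scal_F: "scal F = fun_scale"
  by (simp add: finite_dual_def)

lemma finite_dual_lin: "f \<in> carrier F \<Longrightarrow> lin A ground f"
  by (simp add: finite_dual_iff)

text \<open>Ideals in the kernel: the whole algebra for 0, the intersection for a sum, the same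
  ideal for a multiple.\<close>

lemma vspace_F: "vspace F"
proof -
  interpret D: vector_space "fun_scale :: 'k \<Rightarrow> ('a \<Rightarrow> 'k) \<Rightarrow> _" by (rule vector_space_fun_scale)
  have "D.subspace (carrier F)"
  proof (rule D.subspaceI)
    have "finite_codim scale UNIV" unfolding finite_codim_def by (rule exI[of _ "{}"]) auto
    then show "0 \<in> carrier F"
      by (auto simp: finite_dual_iff two_sided_ideal_def lin_def ground_def
          intro!: exI[of _ UNIV])
  next
    fix f g assume "f \<in> carrier F" "g \<in> carrier F"
    then obtain I J where I: "two_sided_ideal scale I" "finite_codim scale I" "\<forall>x\<in>I. f x = 0"
      and J: "two_sided_ideal scale J" "finite_codim scale J" "\<forall>x\<in>J. g x = 0"
      and lin: "lin A ground f" "lin A ground g"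
      by (auto simp: finite_dual_iff)
    have "two_sided_ideal scale (I \<inter> J)"
      using I(1) J(1) by (auto simp: two_sided_ideal_def intro: subspace_inter)
    moreover have "finite_codim scale (I \<inter> J)"
      using I J by (intro finite_codim_Int) (auto simp: two_sided_ideal_def)
    moreover have "lin A ground (f + g)" using lin by (auto simp: lin_def ground_def algebra_simps)
    ultimately show "f + g \<in> carrier F"
      using I(3) J(3) by (auto simp: finite_dual_iff intro!: exI[of _ "I \<inter> J"])
  next
    fix c f assume "f \<in> carrier F"
    then show "fun_scale c f \<in> carrier F"
      by (auto simp: finite_dual_iff fun_scale_def lin_def ground_def algebra_simps)
  qed
  then show ?thesis by (simp add: vspace_def scal_F vector_space_fun_scale)
qed

section \<open>The comultiplication\<close>

lemma lin_eval: "lin F ground (\<lambda>f. f x)"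
  by (rule lin_groundI) (simp_all add: scal_F fun_scale_def)

lemma bilin_eval2: "bilin F F ground (\<lambda>f g. f x * g y)"
  by (rule bilin_mult[OF lin_eval lin_eval])

text \<open>Both factors lie in the finite dual with the same ideal \<open>I\<close> as
  \<open>f\<close>: \<open>\<phi> t\<close> vanishes on it by choice, and
  \<open>f (t * y) = 0\<close> for \<open>y \<in> I\<close> because
  \<open>t * y \<in> I\<close>.\<close>

lemma finite_dual_mult_expansion:
  assumes "f \<in> carrier F"
  obtains T :: "'a set" and u v where "finite T" "\<And>t. t \<in> T \<Longrightarrow> u t \<in> carrier F" "\<And>t. t \<in> T \<Longrightarrow> v t \<in> carrier F"
    and "\<And>x y. f (x * y) = (\<Sum>t\<in>T. u t x * v t y)"
proof -
  obtain I where I: "two_sided_ideal scale I" "finite_codim scale I" "\<And>x. x \<in> I \<Longrightarrow> f x = 0"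
    and f: "lin A ground f"
    using assms by (auto simp: finite_dual_iff)
  have sub: "subspace I" and ideal: "\<And>a x. x \<in> I \<Longrightarrow> a * x \<in> I" "\<And>a x. x \<in> I \<Longrightarrow> x * a \<in> I"
    using I(1) by (auto simp: two_sided_ideal_def)
  obtain T \<phi> where T: "finite T" "\<And>t. lin A ground (\<phi> t)" "\<And>t x. x \<in> I \<Longrightarrow> \<phi> t x = 0"
    and dec: "\<And>x. x - (\<Sum>t\<in>T. scale (\<phi> t x) t) \<in> I"
    using finite_codim_coordinates[OF sub I(2)] by metis
  show thesis
  proof (rule that[of T \<phi> "\<lambda>t y. f (t * y)"])
    show "\<phi> t \<in> carrier F" for t using T I by (auto simp: finite_dual_iff)
    have "lin A ground (\<lambda>y. f (t * y))" for t
      using lin_add[OF f] lin_ground_scal[OF f]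
      by (intro lin_groundI) (simp_all add: distrib_left scale_mult_right)
    then show "(\<lambda>y. f (t * y)) \<in> carrier F" for t
      using I(1,2) I(3)[OF ideal(1)] by (auto simp: finite_dual_iff)
    fix x y
    \<comment> \<open>The remainder of \<open>x\<close> lies in \<open>I\<close>, hence so does its
      product with \<open>y\<close>, and \<open>f\<close> vanishes there.\<close>
    have "f (x * y) = f ((x - (\<Sum>t\<in>T. scale (\<phi> t x) t)) * y + (\<Sum>t\<in>T. scale (\<phi> t x) (t * y)))"
      by (simp add: left_diff_distrib sum_distrib_right scale_mult_left)
    also have "\<dots> = (\<Sum>t\<in>T. f (scale (\<phi> t x) (t * y)))"
      using lin_add[OF f] lin_sum[OF vspace_A f] I(3)[OF ideal(2)[OF dec]] by simp
    also have "\<dots> = (\<Sum>t\<in>T. \<phi> t x * f (t * y))"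
      using lin_ground_scal[OF f] by simp
    finally show "f (x * y) = (\<Sum>t\<in>T. \<phi> t x * f (t * y))" .
  qed (rule T(1))
qed

text \<open>Evaluations at points separate functionals, so their products separate tensors of
  functionals.\<close>

lemma tensor_F_eqI:
  assumes "s \<in> carrier (tensor F F)" "t \<in> carrier (tensor F F)"
    and "\<And>x y. s (\<lambda>f g. f x * g y) = t (\<lambda>f g. f x * g y)"
  shows "s = t"
  by (rule tensor_functionals_separate[OF vspace_F vspace_F, where p = "\<lambda>x f. f x" and q = "\<lambda>x f. f x"])
    (use assms in \<open>auto simp: lin_eval\<close>)

text \<open>This makes the lift in \<open>dual_tensor_map\<close> legitimate. Elements of the dual
  are compared pointwise: on \<open>A \<otimes> A\<close> by linearity of a lift in a parameter,
  elsewhere because both sides are 0.\<close>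

lemma bilin_dual_tensor_map:
  "bilin F F (dual (tensor A A)) (\<lambda>f g. tensor_lift A A ground (\<lambda>x y. f x * g y))"
proof -
  have b: "bilin A A ground (\<lambda>x y. f x * g y)" if "f \<in> carrier F" "g \<in> carrier F" for f g
    using that by (intro bilin_mult finite_dual_lin)
  have into: "tensor_lift A A ground (\<lambda>x y. f x * g y) \<in> carrier (dual (tensor A A))"
    if "f \<in> carrier F" "g \<in> carrier F" for f g
    using tensor_lift[OF vspace_ground b[OF that]] by (simp add: dual_def)
  have lin_dualI: "lin F (dual (tensor A A)) h"
    if h: "\<And>f. f \<in> carrier F \<Longrightarrow> h f \<in> carrier (dual (tensor A A))"
      and lin: "\<And>s. s \<in> carrier (tensor A A) \<Longrightarrow> lin F ground (\<lambda>f. h f s)" for h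
    unfolding lin_def
  proof (intro conjI ballI allI h)
    have out: "h f s = 0" if "f \<in> carrier F" "s \<notin> carrier (tensor A A)" for f s
      using h that by (simp add: dual_def)
    fix f c assume f: "f \<in> carrier F"
    show "h (scal F c f) = scal (dual (tensor A A)) c (h f)"
    proof
      fix s show "h (scal F c f) s = scal (dual (tensor A A)) c (h f) s"
        using out f scal_closed[OF vspace_F f] lin_ground_scal[OF lin f]
        by (cases "s \<in> carrier (tensor A A)") (simp_all add: dual_def fun_scale_def)
    qed
    fix g assume g: "g \<in> carrier F"
    show "h (f + g) = h f + h g"
    proof
      fix s show "h (f + g) s = (h f + h g) s"
        using out f g add_closed[OF vspace_F f g] lin_add[OF lin f g]
        by (cases "s \<in> carrier (tensor A A)") simp_all
    qed
  qed
  have cmult: "lin F ground (\<lambda>f. f x * c)" "lin F ground (\<lambda>f. c * f x)" for x c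
    by (auto intro!: lin_groundI simp: scal_F fun_scale_def algebra_simps)
  show ?thesis
    by (intro bilinI lin_dualI into lin_tensor_lift_parameter[OF vspace_F vspace_ground] b cmult)
qed

text \<open>Evaluation at a generator is a functional on the dual and so passes through the lift.
  The resulting values are those that separate tensors, whence the natural map is injective on
  \<open>F \<otimes> F\<close>.\<close>

lemma dual_tensor_map_apply:
  assumes "t \<in> carrier (tensor F F)"
  shows "dual_tensor_map scale F t (tns A A x y) = t (\<lambda>f g. f x * g y)"
proof -
  have "lin (dual (tensor A A)) ground (\<lambda>h. h (tns A A x y))"
    by (rule lin_groundI) (simp_all add: dual_def fun_scale_def)
  then have "dual_tensor_map scale F t (tns A A x y)
      = t (\<lambda>f g. tensor_lift A A ground (\<lambda>x y. f x * g y) (tns A A x y))"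
    unfolding dual_tensor_map_def
    using functional_tensor_lift[OF vspace_dual bilin_dual_tensor_map _ assms] by blast
  also have "\<dots> = t (\<lambda>f g. f x * g y)"
    by (rule tensor_apply_cong[OF vspace_F vspace_F assms])
      (simp add: tensor_lift_tns[OF vspace_ground bilin_mult] finite_dual_lin)
  finally show ?thesis .
qed

text \<open>\<open>inv_into\<close> returns \<open>t\<close> because the natural map is injective
  and sends \<open>t\<close> to \<open>f \<circ> mult_map scale\<close>: on generators this is the
  hypothesis, and outside \<open>A \<otimes> A\<close> both functions are 0.\<close>

lemma finite_dual_comult_eqI:
  assumes f: "f \<in> carrier F" and t: "t \<in> carrier (tensor F F)"
    and eq: "\<And>x y. t (\<lambda>f g. f x * g y) = f (x * y)"
  shows "finite_dual_comult scale f = t"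
proof -
  let ?D = "dual_tensor_map scale F"
  have "bilin A A A (*)"
    by (simp add: bilin_def lin_def distrib_left distrib_right scale_mult_left scale_mult_right)
  note mult = tensor_lift[OF vspace_A this, folded mult_map_def]
  have lin_D: "lin (tensor F F) (dual (tensor A A)) ?D"
    unfolding dual_tensor_map_def by (rule lin_tensor_lift[OF vspace_dual bilin_dual_tensor_map])
  have lin_f: "lin (tensor A A) ground (f \<circ> mult_map scale)"
    using lin_compose[OF mult(1) finite_dual_lin[OF f]] by (simp add: comp_def)
  have Dt: "lin (tensor A A) ground (?D t)" "\<And>s. s \<notin> carrier (tensor A A) \<Longrightarrow> ?D t s = 0"
    using lin_in[OF lin_D t] by (auto simp: dual_def)
  have D_eq: "?D t = f \<circ> mult_map scale"
  proof
    fix s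
    show "?D t s = (f \<circ> mult_map scale) s"
    proof (cases "s \<in> carrier (tensor A A)")
      case True
      show ?thesis
        by (rule tensor_lift_unique[OF Dt(1) lin_f vspace_ground _ True])
          (use dual_tensor_map_apply[OF t] mult(2) eq in simp)
    next
      case False
      then show ?thesis
        using Dt(2) mult(3) lin_zero[OF vspace_A finite_dual_lin[OF f]] by simp
    qed
  qed
  have "inj_on ?D (carrier (tensor F F))"
    by (rule inj_onI, rule tensor_F_eqI) (simp_all flip: dual_tensor_map_apply)
  then show ?thesis
    unfolding finite_dual_comult_def D_eq[symmetric] using t by (rule inv_into_f_f)
qed

text \<open>The expansion of \<open>f (x * y)\<close> supplies a tensor with the required values,
  which \<open>finite_dual_comult_eqI\<close> identifies.\<close>

lemma finite_dual_comult:
  assumes "f \<in> carrier F"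
  shows finite_dual_comult_closed: "finite_dual_comult scale f \<in> carrier (tensor F F)"
    and finite_dual_comult_apply: "finite_dual_comult scale f (\<lambda>g h. g x * h y) = f (x * y)"
proof -
  obtain T :: "'a set" and u v where "finite T"
    and uv: "\<And>t. t \<in> T \<Longrightarrow> u t \<in> carrier F" "\<And>t. t \<in> T \<Longrightarrow> v t \<in> carrier F"
    and exp: "\<And>x y. f (x * y) = (\<Sum>t\<in>T. u t x * v t y)"
    by (rule finite_dual_mult_expansion[OF assms], rule that)
  obtain t where t: "t \<in> carrier (tensor F F)"
    and "\<And>\<beta>. bilin F F ground \<beta> \<Longrightarrow> t \<beta> = (\<Sum>i\<in>T. \<beta> (u i) (v i))"
    by (rule tensor_sum_exists[of T u F v F, OF uv], assumption+, rule that)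
  then have eq: "t (\<lambda>g h. g x * h y) = f (x * y)" for x y
    using bilin_eval2 exp by simp
  have "finite_dual_comult scale f = t" by (rule finite_dual_comult_eqI[OF assms t eq])
  then show "finite_dual_comult scale f \<in> carrier (tensor F F)"
    and "finite_dual_comult scale f (\<lambda>g h. g x * h y) = f (x * y)"
    using t eq by simp_all
qed

text \<open>Sums and multiples of the tensors already take the required values, and these values
  determine the comultiplication.\<close>

lemma lin_finite_dual_comult: "lin F (tensor F F) (finite_dual_comult scale)"
  unfolding lin_def
proof (intro conjI ballI allI finite_dual_comult_closed)
  fix f g c assume f: "f \<in> carrier F"
  show "finite_dual_comult scale (scal F c f) = scal (tensor F F) c (finite_dual_comult scale f)"
    using f by (intro finite_dual_comult_eqI scal_closed[OF vspace_F] scal_closed[OF vspace_tensor]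
        finite_dual_comult_closed)
      (simp_all add: scal_tensor scal_F fun_scale_def finite_dual_comult_apply)
  assume g: "g \<in> carrier F"
  show "finite_dual_comult scale (f + g) = finite_dual_comult scale f + finite_dual_comult scale g"
    using f g by (intro finite_dual_comult_eqI add_closed[OF vspace_F] add_closed[OF vspace_tensor]
        finite_dual_comult_closed)
      (simp_all add: finite_dual_comult_apply)
qed

section \<open>Coassociativity\<close>

lemma finite_dual_coassoc:
  assumes c: "c \<in> carrier F"
  shows "tensor_assoc F F F (tensor_map F F (tensor F F) F (finite_dual_comult scale) id
      (finite_dual_comult scale c))
    = tensor_map F F F (tensor F F) id (finite_dual_comult scale) (finite_dual_comult scale c)"
proof -
  let ?\<Delta> = "finite_dual_comult scale"
  let ?t = "?\<Delta> c"
  let ?assoc = "tensor_assoc F F F"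
  let ?l = "tensor_map F F (tensor F F) F ?\<Delta> id"
  let ?r = "tensor_map F F F (tensor F F) id ?\<Delta>"
  \<comment> \<open>The separating functionals on the factor \<open>F \<otimes> F\<close> are
    indexed by pairs, since the separation lemma takes a single index per factor.\<close>
  let ?q = "\<lambda>(y, z) (s :: (('a \<Rightarrow> 'k) \<Rightarrow> ('a \<Rightarrow> 'k) \<Rightarrow> 'k) \<Rightarrow> 'k). s (\<lambda>g h. g y * h z)"
  note F = vspace_F and FF = vspace_tensor[of F F] and \<Delta> = lin_finite_dual_comult
  have t: "?t \<in> carrier (tensor F F)" by (rule finite_dual_comult_closed[OF c])
  have q: "lin (tensor F F) ground (?q yz)" for yz
    by (cases yz) (simp add: lin_tensor_apply)
  note l = lin_tensor_map[OF FF F \<Delta> lin_id] and r = lin_tensor_map[OF F FF lin_id \<Delta>]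
    and assoc = lin_tensor_assoc[OF F F F]
  show ?thesis
  proof (rule tensor_functionals_separate[OF F FF, where p = "\<lambda>x f. f x" and q = ?q])
    show "lin F ground (\<lambda>f. f x)" for x by (rule lin_eval)
    show "lin (tensor F F) ground (?q yz)" for yz by (rule q)
    show "f = 0" if "\<And>x. f x = 0" for f :: "'a \<Rightarrow> 'k" using that by auto
    show "s = 0" if "s \<in> carrier (tensor F F)" "\<And>yz. ?q yz s = 0" for s
      using that(2) by (intro tensor_F_eqI that(1) zero_closed[OF FF]) auto
    show "?assoc (?l ?t) \<in> carrier (tensor F (tensor F F))" by (rule lin_in[OF assoc lin_in[OF l t]])
    show "?r ?t \<in> carrier (tensor F (tensor F F))" by (rule lin_in[OF r t])
    fix x :: 'a and yz :: "'a \<times> 'a"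
    obtain y z where yz: "yz = (y, z)" by (cases yz)
    let ?\<beta> = "\<lambda>f s. f x * ?q yz s"
    have \<beta>: "bilin F (tensor F F) ground ?\<beta>" by (rule bilin_mult[OF lin_eval q])
    have \<beta>_tns: "tns F (tensor F F) f s ?\<beta> = f x * s (\<lambda>g h. g y * h z)" for f s
      using \<beta> by (simp add: tns_def yz)
    have tns_eval: "tns F F g h (\<lambda>g h. g y * h z) = g y * h z" for g h y z
      using bilin_eval2 by (simp add: tns_def)
    have "?assoc (?l ?t) ?\<beta> = ?t (\<lambda>f g. ?assoc (tns (tensor F F) F (?\<Delta> f) (id g)) ?\<beta>)"
      by (rule functional_tensor_map[OF FF F \<Delta> lin_id lin_compose[OF assoc lin_tensor_apply] t])
    also have "\<dots> = ?t (\<lambda>f g. f (x * y) * g z)"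
    proof (rule tensor_apply_cong[OF F F t])
      fix f g assume f: "f \<in> carrier F" and g: "g \<in> carrier F"
      note \<Delta>f = finite_dual_comult_closed[OF f]
      have "?assoc (tns (tensor F F) F (?\<Delta> f) (id g)) ?\<beta>
          = ?\<Delta> f (\<lambda>u v. tns F (tensor F F) u (tns F F v g) ?\<beta>)"
        unfolding id_apply by (rule functional_tensor_assoc_tns[OF F F F lin_tensor_apply \<Delta>f g])
      also have "\<dots> = ?\<Delta> f (\<lambda>u v. (u x * v y) * g z)"
        by (simp add: \<beta>_tns tns_eval mult.assoc)
      also have "\<dots> = ?\<Delta> f (\<lambda>u v. u x * v y) * g z"
      proof -
        \<comment> \<open>Multiplication by \<open>g z\<close> is a functional on the ground field;
          passing it through the lift pulls the constant factor out of the form.\<close>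
        have "lin ground ground (\<lambda>k. k * g z)" by (simp add: lin_def ground_def algebra_simps)
        from functional_tensor_lift[OF vspace_ground bilin_eval2 this \<Delta>f, of x y]
        show ?thesis using \<Delta>f by (simp add: tensor_lift_ground[OF bilin_eval2])
      qed
      finally show "?assoc (tns (tensor F F) F (?\<Delta> f) (id g)) ?\<beta> = f (x * y) * g z"
        by (simp add: finite_dual_comult_apply[OF f])
    qed
    \<comment> \<open>The value is \<open>c ((x * y) * z)\<close>; associativity of the algebra
      enters here.\<close>
    also have "\<dots> = c (x * (y * z))" by (simp add: finite_dual_comult_apply[OF c] mult.assoc)
    also have "\<dots> = ?t (\<lambda>f g. f x * g (y * z))" by (simp add: finite_dual_comult_apply[OF c])
    also have "\<dots> = ?t (\<lambda>f g. tns F (tensor F F) (id f) (?\<Delta> g) ?\<beta>)"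
      by (rule tensor_apply_cong[OF F F t]) (simp add: \<beta>_tns finite_dual_comult_apply)
    also have "\<dots> = ?r ?t ?\<beta>"
      by (rule functional_tensor_map[OF F FF lin_id \<Delta> lin_tensor_apply t, symmetric])
    finally show "?assoc (?l ?t) ?\<beta> = ?r ?t ?\<beta>" .
  qed
qed

end

section \<open>The counit\<close>

context algebra_enough_idempotents
begin

section \<open>Local units from the idempotents\<close>

lemma sum_idempotents_right:
  obtains G where "finite G" "G \<subseteq> R"
    and "\<And>G'. finite G' \<Longrightarrow> G \<subseteq> G' \<Longrightarrow> G' \<subseteq> R \<Longrightarrow> (\<Sum>\<alpha>\<in>G'. x * e \<alpha>) = x"
    and "\<And>\<beta>. \<beta> \<in> R \<Longrightarrow> \<beta> \<notin> G \<Longrightarrow> x * e \<beta> = 0"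
proof -
  obtain g where g: "\<forall>\<alpha>\<in>R. g \<alpha> \<in> {a * e \<alpha> | a. True}" "\<forall>\<alpha>. \<alpha> \<notin> R \<longrightarrow> g \<alpha> = 0"
    and fin: "finite {\<alpha>. g \<alpha> \<noteq> 0}" and x: "x = (\<Sum>\<alpha>\<in>{\<alpha>. g \<alpha> \<noteq> 0}. g \<alpha>)"
    using ex1_implies_ex[OF spec[OF left_sum[unfolded internal_direct_sum_def], of x]]
    by (elim exE conjE) (rule that)
  let ?G = "{\<alpha>. g \<alpha> \<noteq> 0}"
  have GR: "?G \<subseteq> R" using g(2) by auto
  have ge: "g \<alpha> * e \<beta> = (if \<alpha> = \<beta> then g \<beta> else 0)" if R: "\<alpha> \<in> R" "\<beta> \<in> R" for \<alpha> \<beta>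
  proof -
    obtain a where "g \<alpha> = a * e \<alpha>" using bspec[OF g(1) R(1)] by blast
    then show ?thesis using R idempotent orthogonal by (auto simp: mult.assoc)
  qed
  have xe: "x * e \<beta> = g \<beta>" if "\<beta> \<in> R" for \<beta>
  proof -
    have "x * e \<beta> = (\<Sum>\<alpha>\<in>?G. g \<alpha> * e \<beta>)" by (subst x) (simp add: sum_distrib_right)
    also have "\<dots> = (\<Sum>\<alpha>\<in>?G. if \<alpha> = \<beta> then g \<beta> else 0)"
      using GR that by (intro sum.cong) (auto simp: ge)
    also have "\<dots> = g \<beta>" using fin by simp
    finally show ?thesis .
  qed
  show thesis
  proof (rule that[OF fin GR])
    fix G' assume G': "finite G'" "?G \<subseteq> G'" "G' \<subseteq> R"
    have "(\<Sum>\<alpha>\<in>G'. x * e \<alpha>) = (\<Sum>\<alpha>\<in>G'. g \<alpha>)" using G' by (intro sum.cong) (auto simp: xe)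
    also have "\<dots> = x" using G' by (subst x) (auto intro: sum.mono_neutral_right)
    finally show "(\<Sum>\<alpha>\<in>G'. x * e \<alpha>) = x" .
  qed (simp add: xe)
qed

text \<open>The mirror image, from the decomposition into the \<open>e \<alpha> A\<close>.\<close>

lemma sum_idempotents_left:
  obtains G where "finite G" "G \<subseteq> R"
    and "\<And>G'. finite G' \<Longrightarrow> G \<subseteq> G' \<Longrightarrow> G' \<subseteq> R \<Longrightarrow> (\<Sum>\<alpha>\<in>G'. e \<alpha> * x) = x"
proof -
  obtain g where g: "\<forall>\<alpha>\<in>R. g \<alpha> \<in> {e \<alpha> * a | a. True}" "\<forall>\<alpha>. \<alpha> \<notin> R \<longrightarrow> g \<alpha> = 0"
    and fin: "finite {\<alpha>. g \<alpha> \<noteq> 0}" and x: "x = (\<Sum>\<alpha>\<in>{\<alpha>. g \<alpha> \<noteq> 0}. g \<alpha>)"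
    using ex1_implies_ex[OF spec[OF right_sum[unfolded internal_direct_sum_def], of x]]
    by (elim exE conjE) (rule that)
  let ?G = "{\<alpha>. g \<alpha> \<noteq> 0}"
  have GR: "?G \<subseteq> R" using g(2) by auto
  have eg: "e \<beta> * g \<alpha> = (if \<alpha> = \<beta> then g \<beta> else 0)" if R: "\<alpha> \<in> R" "\<beta> \<in> R" for \<alpha> \<beta>
  proof -
    obtain a where "g \<alpha> = e \<alpha> * a" using bspec[OF g(1) R(1)] by blast
    then show ?thesis using R idempotent orthogonal by (auto simp flip: mult.assoc)
  qed
  have ex: "e \<beta> * x = g \<beta>" if "\<beta> \<in> R" for \<beta>
  proof -
    have "e \<beta> * x = (\<Sum>\<alpha>\<in>?G. e \<beta> * g \<alpha>)" by (subst x) (simp add: sum_distrib_left)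
    also have "\<dots> = (\<Sum>\<alpha>\<in>?G. if \<alpha> = \<beta> then g \<beta> else 0)"
      using GR that by (intro sum.cong) (auto simp: eg)
    also have "\<dots> = g \<beta>" using fin by simp
    finally show ?thesis .
  qed
  show thesis
  proof (rule that[OF fin GR])
    fix G' assume G': "finite G'" "?G \<subseteq> G'" "G' \<subseteq> R"
    have "(\<Sum>\<alpha>\<in>G'. e \<alpha> * x) = (\<Sum>\<alpha>\<in>G'. g \<alpha>)" using G' by (intro sum.cong) (auto simp: ex)
    also have "\<dots> = x" using G' by (subst x) (auto intro: sum.mono_neutral_right)
    finally show "(\<Sum>\<alpha>\<in>G'. e \<alpha> * x) = x" .
  qed
qed

text \<open>If finitely many elements span \<open>A\<close> modulo \<open>I\<close>, then almost all \<open>e \<alpha>\<close> annihilate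
  them from the right. Such an \<open>e \<alpha>\<close>, being congruent to a combination of them, satisfies
  \<open>e \<alpha> = e \<alpha> * e \<alpha> \<in> I\<close>.\<close>

lemma finite_idempotents_outside_ideal:
  assumes I: "two_sided_ideal scale I" and fin: "finite_codim scale I"
  shows "finite {\<alpha> \<in> R. e \<alpha> \<notin> I}"
proof -
  obtain S where S: "finite S" and dec: "\<And>x. \<exists>y\<in>span S. x - y \<in> I"
    using fin unfolding finite_codim_def by blast
  have "\<exists>G. finite G \<and> (\<forall>\<beta>. \<beta> \<in> R \<longrightarrow> \<beta> \<notin> G \<longrightarrow> s * e \<beta> = 0)" for s
    using sum_idempotents_right[of s] by metis
  then obtain G where G: "\<And>s. finite (G s)" "\<And>s \<beta>. \<beta> \<in> R \<Longrightarrow> \<beta> \<notin> G s \<Longrightarrow> s * e \<beta> = 0"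
    by metis
  have "e \<alpha> \<in> I" if \<alpha>: "\<alpha> \<in> R" "\<alpha> \<notin> (\<Union>s\<in>S. G s)" for \<alpha>
  proof -
    obtain y where y: "y \<in> span S" "e \<alpha> - y \<in> I" using dec by blast
    from y(1) have "y * e \<alpha> = 0"
    proof (induction rule: span_induct_alt)
      case (step c x y)
      then show ?case using G(2)[of \<alpha> x] \<alpha> by (simp add: distrib_right scale_mult_left)
    qed simp
    then have "e \<alpha> = (e \<alpha> - y) * e \<alpha>" by (simp add: left_diff_distrib idempotent[OF \<alpha>(1)])
    also have "\<dots> \<in> I" using I y(2) by (auto simp: two_sided_ideal_def)
    finally show ?thesis .
  qed
  then have "{\<alpha> \<in> R. e \<alpha> \<notin> I} \<subseteq> (\<Union>s\<in>S. G s)" by blast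
  then show ?thesis using S G(1) by (auto intro: finite_subset)
qed

section \<open>The counit as a linear functional\<close>

abbreviation supp where "supp f \<equiv> {\<alpha> \<in> R. f (e \<alpha>) \<noteq> 0}"

lemma finite_supp:
  assumes "f \<in> carrier F"
  shows "finite (supp f)"
proof -
  obtain I where "two_sided_ideal scale I" "finite_codim scale I" "\<forall>x\<in>I. f x = 0"
    using assms by (auto simp: finite_dual_iff)
  then show ?thesis
    by (intro finite_subset[OF _ finite_idempotents_outside_ideal[of I]]) auto
qed

text \<open>Terms off the support are 0; the counits of several functionals can thus be computed
  over a common index set.\<close>

lemma finite_dual_counit_eq:
  assumes "finite G" "supp f \<subseteq> G" "G \<subseteq> R"
  shows "finite_dual_counit R e f = (\<Sum>\<alpha>\<in>G. f (e \<alpha>))"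
  unfolding finite_dual_counit_def using assms by (intro sum.mono_neutral_left) auto

lemma lin_finite_dual_counit: "lin F ground (finite_dual_counit R e)"
proof (rule lin_groundI)
  fix f g assume f: "f \<in> carrier F" and g: "g \<in> carrier F"
  let ?G = "supp f \<union> supp g"
  have G: "finite ?G" "?G \<subseteq> R" using finite_supp f g by auto
  have "supp (f + g) \<subseteq> ?G" by auto
  then show "finite_dual_counit R e (f + g) = finite_dual_counit R e f + finite_dual_counit R e g"
    using finite_dual_counit_eq[OF G(1) _ G(2), of f] finite_dual_counit_eq[OF G(1) _ G(2), of g]
      finite_dual_counit_eq[OF G(1) _ G(2), of "f + g"]
    by (simp add: sum.distrib)
next
  fix c f assume f: "f \<in> carrier F"
  \<comment> \<open>For \<open>c = 0\<close> the support shrinks; \<open>supp f\<close> contains it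
    in every case.\<close>
  have "finite_dual_counit R e (fun_scale c f) = (\<Sum>\<alpha>\<in>supp f. fun_scale c f (e \<alpha>))"
    by (rule finite_dual_counit_eq[OF finite_supp[OF f]]) (auto simp: fun_scale_def)
  then show "finite_dual_counit R e (scal F c f) = c * finite_dual_counit R e f"
    by (simp add: finite_dual_counit_def scal_F fun_scale_def sum_distrib_left)
qed

section \<open>The counit laws\<close>

text \<open>A tensor involves finitely many functionals, each of finite support; over the union of
  the supports the counit inside \<open>t\<close> becomes a finite sum of evaluations.\<close>

lemma tensor_finite_dual_supp:
  assumes t: "t \<in> carrier (tensor F F)"
  obtains G where "finite G" "G \<subseteq> R"
    and "\<And>G' y. finite G' \<Longrightarrow> G \<subseteq> G' \<Longrightarrow> G' \<subseteq> R \<Longrightarrow>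
      t (\<lambda>f g. finite_dual_counit R e f * g y) = (\<Sum>\<alpha>\<in>G'. t (\<lambda>f g. f (e \<alpha>) * g y))"
    and "\<And>G' x. finite G' \<Longrightarrow> G \<subseteq> G' \<Longrightarrow> G' \<subseteq> R \<Longrightarrow>
      t (\<lambda>f g. f x * finite_dual_counit R e g) = (\<Sum>\<alpha>\<in>G'. t (\<lambda>f g. f x * g (e \<alpha>)))"
proof -
  interpret D: vector_space "fun_scale :: 'k \<Rightarrow> ('a \<Rightarrow> 'k) \<Rightarrow> _" by (rule vector_space_fun_scale)
  let ?\<epsilon> = "finite_dual_counit R e"
  obtain S u where S: "finite S" "S \<subseteq> carrier F" and u: "\<And>b. u b \<in> carrier F"
    and exp: "\<And>\<beta>. bilin F F ground \<beta> \<Longrightarrow> t \<beta> = (\<Sum>b\<in>S. \<beta> (u b) b)"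
    using tensor_basis_expansion[OF vspace_F vspace_F t, of "carrier F"] D.span_superset
    unfolding scal_F by blast
  let ?G = "(\<Union>b\<in>S. supp (u b) \<union> supp b)"
  show thesis
  proof (rule that[of ?G])
    show "finite ?G" using S u finite_supp by auto
    fix G' assume G': "finite G'" "?G \<subseteq> G'" "G' \<subseteq> R"
    have \<epsilon>: "?\<epsilon> b = (\<Sum>\<alpha>\<in>G'. b (e \<alpha>))" "?\<epsilon> (u b) = (\<Sum>\<alpha>\<in>G'. u b (e \<alpha>))" if "b \<in> S" for b
      using G' that by (auto intro!: finite_dual_counit_eq)
    show "t (\<lambda>f g. ?\<epsilon> f * g y) = (\<Sum>\<alpha>\<in>G'. t (\<lambda>f g. f (e \<alpha>) * g y))" for y
      by (simp add: exp bilin_eval2 bilin_mult[OF lin_finite_dual_counit lin_eval] \<epsilon> sum_distrib_right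
          sum.swap[of _ G' S])
    show "t (\<lambda>f g. f x * ?\<epsilon> g) = (\<Sum>\<alpha>\<in>G'. t (\<lambda>f g. f x * g (e \<alpha>)))" for x
      by (simp add: exp bilin_eval2 bilin_mult[OF lin_eval lin_finite_dual_counit] \<epsilon> sum_distrib_left
          sum.swap[of _ G' S])
  qed auto
qed

text \<open>The values are finite sums of \<open>c (e \<alpha> * x)\<close> and of
  \<open>c (x * e \<alpha>)\<close>; linearity of \<open>c\<close> moves the sum inside, where it
  equals \<open>x\<close>.\<close>

lemma finite_dual_comult_counit:
  assumes c: "c \<in> carrier F"
  shows "finite_dual_comult scale c (\<lambda>f g. finite_dual_counit R e f * g x) = c x"
    and "finite_dual_comult scale c (\<lambda>f g. f x * finite_dual_counit R e g) = c x"
proof -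
  note c_sum = lin_sum[OF vspace_A finite_dual_lin[OF c], symmetric, simplified]
  obtain G where G: "finite G" "G \<subseteq> R"
    "\<And>G' y. finite G' \<Longrightarrow> G \<subseteq> G' \<Longrightarrow> G' \<subseteq> R \<Longrightarrow>
      finite_dual_comult scale c (\<lambda>f g. finite_dual_counit R e f * g y) = (\<Sum>\<alpha>\<in>G'. c (e \<alpha> * y))"
    "\<And>G' x. finite G' \<Longrightarrow> G \<subseteq> G' \<Longrightarrow> G' \<subseteq> R \<Longrightarrow>
      finite_dual_comult scale c (\<lambda>f g. f x * finite_dual_counit R e g) = (\<Sum>\<alpha>\<in>G'. c (x * e \<alpha>))"
    using tensor_finite_dual_supp[OF finite_dual_comult_closed[OF c]]
    unfolding finite_dual_comult_apply[OF c] by metis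
  obtain H where H: "finite H" "H \<subseteq> R"
    "\<And>G'. finite G' \<Longrightarrow> H \<subseteq> G' \<Longrightarrow> G' \<subseteq> R \<Longrightarrow> (\<Sum>\<alpha>\<in>G'. e \<alpha> * x) = x"
    using sum_idempotents_left[of x] by metis
  obtain H' where H': "finite H'" "H' \<subseteq> R"
    "\<And>G'. finite G' \<Longrightarrow> H' \<subseteq> G' \<Longrightarrow> G' \<subseteq> R \<Longrightarrow> (\<Sum>\<alpha>\<in>G'. x * e \<alpha>) = x"
    using sum_idempotents_right[of x] by metis
  \<comment> \<open>\<open>G\<close> turns the counit into a sum, \<open>H\<close> makes that sum
    reproduce \<open>x\<close>; both tolerate enlargement, so the union serves.\<close>
  show "finite_dual_comult scale c (\<lambda>f g. finite_dual_counit R e f * g x) = c x"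
    using G(1,2) H G(3)[of "G \<union> H" x] by (simp add: c_sum)
  show "finite_dual_comult scale c (\<lambda>f g. f x * finite_dual_counit R e g) = c x"
    using G(1,2) H' G(4)[of "G \<union> H'" x] by (simp add: c_sum)
qed

text \<open>The identity alone separates points of the ground field, hence the index type
  \<open>unit\<close>; together with evaluations it reduces the law to
  \<open>finite_dual_comult_counit\<close>.\<close>

lemma finite_dual_counit_left:
  assumes c: "c \<in> carrier F"
  shows "tensor_map F F ground F (finite_dual_counit R e) id (finite_dual_comult scale c)
    = tns ground F 1 c"
proof -
  let ?m = "tensor_map F F ground F (finite_dual_counit R e) id"
  let ?t = "finite_dual_comult scale c"
  note F = vspace_F and K = vspace_ground and \<epsilon> = lin_finite_dual_counit
  have t: "?t \<in> carrier (tensor F F)" by (rule finite_dual_comult_closed[OF c])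
  show ?thesis
  proof (rule tensor_functionals_separate[OF K F, where p = "\<lambda>_ :: unit. \<lambda>k. k" and q = "\<lambda>x f. f x"])
    show "lin ground ground (\<lambda>k. k)" by (simp add: lin_def)
    show "lin F ground (\<lambda>f. f x)" for x by (rule lin_eval)
    show "?m ?t \<in> carrier (tensor ground F)" by (rule lin_in[OF lin_tensor_map[OF K F \<epsilon> lin_id] t])
    show "tns ground F 1 c \<in> carrier (tensor ground F)"
      using c by (intro tns_in_tensor) (simp_all add: ground_def)
    fix x
    have \<beta>: "bilin ground F ground (\<lambda>k f. k * f x)"
      by (rule bilin_mult[OF _ lin_eval]) (simp add: lin_def)
    have "?m ?t (\<lambda>k f. k * f x)
        = ?t (\<lambda>f g. tns ground F (finite_dual_counit R e f) (id g) (\<lambda>k f. k * f x))"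
      by (rule functional_tensor_map[OF K F \<epsilon> lin_id lin_tensor_apply t])
    also have "\<dots> = c x" using \<beta> finite_dual_comult_counit(1)[OF c] by (simp add: tns_def)
    finally show "?m ?t (\<lambda>k f. k * f x) = tns ground F 1 c (\<lambda>k f. k * f x)"
      using \<beta> by (simp add: tns_def)
  qed auto
qed

lemma finite_dual_counit_right:
  assumes c: "c \<in> carrier F"
  shows "tensor_map F F F ground id (finite_dual_counit R e) (finite_dual_comult scale c)
    = tns F ground c 1"
proof -
  let ?m = "tensor_map F F F ground id (finite_dual_counit R e)"
  let ?t = "finite_dual_comult scale c"
  note F = vspace_F and K = vspace_ground and \<epsilon> = lin_finite_dual_counit
  have t: "?t \<in> carrier (tensor F F)" by (rule finite_dual_comult_closed[OF c])
  show ?thesis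
  proof (rule tensor_functionals_separate[OF F K, where p = "\<lambda>x f. f x" and q = "\<lambda>_ :: unit. \<lambda>k. k"])
    show "lin ground ground (\<lambda>k. k)" by (simp add: lin_def)
    show "lin F ground (\<lambda>f. f x)" for x by (rule lin_eval)
    show "?m ?t \<in> carrier (tensor F ground)" by (rule lin_in[OF lin_tensor_map[OF F K lin_id \<epsilon>] t])
    show "tns F ground c 1 \<in> carrier (tensor F ground)"
      using c by (intro tns_in_tensor) (simp_all add: ground_def)
    fix x
    have \<beta>: "bilin F ground ground (\<lambda>f k. f x * k)"
      by (rule bilin_mult[OF lin_eval]) (simp add: lin_def)
    have "?m ?t (\<lambda>f k. f x * k)
        = ?t (\<lambda>f g. tns F ground (id f) (finite_dual_counit R e g) (\<lambda>f k. f x * k))"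
      by (rule functional_tensor_map[OF F K lin_id \<epsilon> lin_tensor_apply t])
    also have "\<dots> = c x" using \<beta> finite_dual_comult_counit(2)[OF c] by (simp add: tns_def)
    finally show "?m ?t (\<lambda>f k. f x * k) = tns F ground c 1 (\<lambda>f k. f x * k)"
      using \<beta> by (simp add: tns_def)
  qed auto
qed

end

theorem proposition2p4:
  fixes scale :: "'k::field \<Rightarrow> 'a::ring \<Rightarrow> 'a"
    and R :: "'r set" and e :: "'r \<Rightarrow> 'a"
  assumes "algebra_enough_idempotents scale R e"
  shows "coalgebra (finite_dual scale) (finite_dual_comult scale) (finite_dual_counit R e)"
proof -
  interpret algebra_enough_idempotents scale R e by fact
  show ?thesis
    unfolding coalgebra_def
    by (intro conjI ballI vspace_F lin_finite_dual_comult lin_finite_dual_counit finite_dual_coassoc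
        finite_dual_counit_left finite_dual_counit_right)
qed

end
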